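(* Fix $0<x<1$, let $s=(1-x)\sqrt{x}$, and let $H_x\in\mathcal{RK}$ be the four dimensional space with reproducing kernels $h_1,h_2,h_3,h_4$ and Gram matrix $$(\langle h_i,h_j\rangle)_{i,j=1}^4=\begin{pmatrix} 1 & x & x & x+is \\ x & 1 & x-is & x \\ x & x+is & 1 & x \\ x-is & x & x & 1 \end{pmatrix}.$$ For $1\le i\le4$ let $J_i$ be the regular subspace of $H_x$ spanned by $\{h_r:r\ne i\}$. For a four dimensional $H\in\mathcal{RK}$ with $RK(H)=\{h'_1,\dots,h'_4\}$ write $\{J_i\}\rightrightarrows H$ if, for each $i$, $J_i$ is a rescaling of the regular subspace of $H$ spanned by $\{h'_r:r\ne i\}$ with $h_r$ matched to $h'_r$. Then: (1) Each $J_i$, $1\le i\le 4$, is in $\mathcal{CPP}$, and the $\{J_i\}$ are coherent: for $p\neq q$ the two dimensional regular subspaces of $J_p$ and of $J_q$ spanned by $\{h_r:r\neq p,q\}$ are rescalings of each other, respecting labels. (2) There is an $H\in\mathcal{RK}$ with $\{J_i\}_{i=1}^4\rightrightarrows H$. (3) There is no $H\in\mathcal{CPP}$ with $\{J_i\}_{i=1}^4\rightrightarrows H$.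
   Context: A finite dimensional reproducing kernel Hilbert space (RKHS) is a finite dimensional complex Hilbert space $H$ together with a distinguished basis $RK(H)$ whose elements are called reproducing kernels. $H\in\mathcal{RK}$ means that $H$ is finite dimensional and irreducible, i.e. no two elements of $RK(H)$ are orthogonal. A regular subspace of $H$ is the span $J$ of a subset $S\subset RK(H)$, made an RKHS by $RK(J)=S$. $G$ is a rescaling of $H$ if there are a bijection $\theta:RK(H)\to RK(G)$ and a nonvanishing complex function $\gamma$ on $RK(H)$ with $\langle h,h'\rangle=\gamma(h)\overline{\gamma(h')}\langle\theta(h),\theta(h')\rangle$ for all $h,h'\in RK(H)$; $h$ is then said to be matched to $\theta(h)$. A multiplier on $H$ is a linear operator $M$ whose adjoint $M^*$ has each element of $RK(H)$ as an eigenvector. If $J$ is a regular subspace, a multiplier $M$ on $H$ extends a multiplier $M_J$ on $J$ if $M^*$ restricted to $J$ is $M_J^*$. $H\in\mathcal{RK}$ has the complete Pick property, written $H\in\mathcal{CPP}$, if for every regular subspace $J$ of $H$ and all $s,t\ge1$, every $s\times t$ matrix of multipliers on $J$, acting from $J^t$ to $J^s$, extends entrywise to an $s\times t$ matrix of multipliers on $H$ with the same operator norm. (The displayed Gram matrix is positive definite for $0<x<1$, so $H_x$ exists.) *)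

theory Defs
  imports "HOL-Analysis.Analysis"
begin

section \<open>Complex inner product spaces\<close>

class scaleC =
  fixes scaleC :: "complex \<Rightarrow> 'a \<Rightarrow> 'a" (infixr "*\<^sub>C" 75)

text \<open>
  The complex inner product is linear in the first and conjugate linear in the second argument.
  The underlying real structure, and with it the norm, is that of the real inner product
  \<open>Re \<langle>x, y\<rangle>\<close>, so that \<open>(norm x)\<^sup>2 = \<langle>x, x\<rangle>\<close>.
\<close>

class complex_inner = real_inner + scaleC +
  fixes cinner :: "'a \<Rightarrow> 'a \<Rightarrow> complex"
  assumes scaleC_add_right: "a *\<^sub>C (x + y) = a *\<^sub>C x + a *\<^sub>C y"
    and scaleC_add_left: "(a + b) *\<^sub>C x = a *\<^sub>C x + b *\<^sub>C x"
    and scaleC_scaleC: "a *\<^sub>C (b *\<^sub>C x) = (a * b) *\<^sub>C x"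
    and scaleR_scaleC: "r *\<^sub>R x = complex_of_real r *\<^sub>C x"
    and cinner_commute: "cinner x y = cnj (cinner y x)"
    and cinner_add_left: "cinner (x + y) z = cinner x z + cinner y z"
    and cinner_scaleC_left: "cinner (a *\<^sub>C x) y = a * cinner x y"
    and inner_eq_Re_cinner: "inner x y = Re (cinner x y)"

global_interpretation complex_vector:
  vector_space "scaleC :: complex \<Rightarrow> 'a \<Rightarrow> 'a::complex_inner"
  defines cspan = complex_vector.span
    and cdependent = complex_vector.dependent
    and csubspace = complex_vector.subspace
    and cdim = complex_vector.dim
    and crepresentation = complex_vector.representation
    and cextend_basis = complex_vector.extend_basis
proof unfold_locales
  show "1 *\<^sub>C x = x" for x :: 'a
    by (metis of_real_1 scaleR_one scaleR_scaleC)
qed (simp_all add: scaleC_add_right scaleC_add_left scaleC_scaleC)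

abbreviation cindependent :: "'a::complex_inner set \<Rightarrow> bool" where
  "cindependent S \<equiv> \<not> cdependent S"

instantiation complex :: complex_inner
begin
definition scaleC_complex_def: "a *\<^sub>C (x::complex) = a * x"
definition cinner_complex_def: "cinner x y = x * cnj y"
instance
  by standard
    (simp_all add: scaleC_complex_def cinner_complex_def inner_complex_def algebra_simps
      scaleR_conv_of_real)
end

instantiation vec :: (complex_inner, finite) complex_inner
begin
definition scaleC_vec_def: "a *\<^sub>C x = (\<chi> i. a *\<^sub>C (x $ i))"
definition cinner_vec_def: "cinner x y = (\<Sum>i\<in>UNIV. cinner (x $ i) (y $ i))"
instance
proof
  show "cinner x y = cnj (cinner y x)" for x y :: "'a ^ 'b"
    unfolding cinner_vec_def cnj_sum by (intro sum.cong refl cinner_commute)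
qed (simp_all add: scaleC_vec_def cinner_vec_def inner_vec_def vec_eq_iff scaleC_add_right
    scaleC_add_left scaleC_scaleC scaleR_scaleC cinner_add_left cinner_scaleC_left
    inner_eq_Re_cinner sum.distrib sum_distrib_left)
end


section \<open>Finite dimensional reproducing kernel Hilbert spaces\<close>

text \<open>
  A finite dimensional RKHS is represented by its distinguished basis \<open>K = RK(H)\<close>, a finite
  linearly independent set of vectors in some complex inner product space; the Hilbert space
  is \<open>H = cspan K\<close>. The regular subspaces of \<open>H\<close> are thus represented by the subsets of \<open>K\<close>.
\<close>

definition rkhs :: "'a::complex_inner set \<Rightarrow> bool" where
  "rkhs K \<longleftrightarrow> finite K \<and> cindependent K"

definition irreducible_rkhs :: "'a::complex_inner set \<Rightarrow> bool" where
  "irreducible_rkhs K \<longleftrightarrow> rkhs K \<and> (\<forall>h\<in>K. \<forall>h'\<in>K. h \<noteq> h' \<longrightarrow> cinner h h' \<noteq> 0)"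

text \<open>\<open>G\<close> is a rescaling of \<open>H\<close> through \<open>\<theta> : RK(H) \<rightarrow> RK(G)\<close>.\<close>

definition rescaling_via ::
  "('b::complex_inner \<Rightarrow> 'a::complex_inner) \<Rightarrow> 'a set \<Rightarrow> 'b set \<Rightarrow> bool" where
  "rescaling_via \<theta> G H \<longleftrightarrow> bij_betw \<theta> H G \<and>
     (\<exists>\<gamma> :: 'b \<Rightarrow> complex. (\<forall>h\<in>H. \<gamma> h \<noteq> 0) \<and>
        (\<forall>h\<in>H. \<forall>h'\<in>H. cinner h h' = \<gamma> h * cnj (\<gamma> h') * cinner (\<theta> h) (\<theta> h')))"

text \<open>
  For kernels labelled by \<open>g\<close> and \<open>h\<close>: the RKHS with kernels \<open>g r\<close>, \<open>r \<in> I\<close>, is a rescaling of the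
  one with kernels \<open>h r\<close>, \<open>r \<in> I\<close>, respecting labels.
\<close>

definition labelled_rescaling ::
  "'i set \<Rightarrow> ('i \<Rightarrow> 'a::complex_inner) \<Rightarrow> ('i \<Rightarrow> 'b::complex_inner) \<Rightarrow> bool" where
  "labelled_rescaling I g h \<longleftrightarrow>
     (\<exists>\<theta>. rescaling_via \<theta> (g ` I) (h ` I) \<and> (\<forall>r\<in>I. \<theta> (h r) = g r))"


section \<open>Multipliers and the complete Pick property\<close>

definition linear_operator_on :: "'a::complex_inner set \<Rightarrow> ('a \<Rightarrow> 'a) \<Rightarrow> bool" where
  "linear_operator_on V M \<longleftrightarrow> (\<forall>u\<in>V. M u \<in> V) \<and>
     (\<forall>u\<in>V. \<forall>v\<in>V. M (u + v) = M u + M v) \<and> (\<forall>a. \<forall>u\<in>V. M (a *\<^sub>C u) = a *\<^sub>C M u)"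

text \<open>
  Adjoint of a linear operator on a finite dimensional subspace \<open>V\<close>, where it exists and is
  unique; only its values on \<open>V\<close> are meaningful.
\<close>

definition adjoint_on :: "'a::complex_inner set \<Rightarrow> ('a \<Rightarrow> 'a) \<Rightarrow> 'a \<Rightarrow> 'a" where
  "adjoint_on V M v = (THE w. w \<in> V \<and> (\<forall>u\<in>V. cinner (M u) v = cinner u w))"

definition multiplier :: "'a::complex_inner set \<Rightarrow> ('a \<Rightarrow> 'a) \<Rightarrow> bool" where
  "multiplier K M \<longleftrightarrow> linear_operator_on (cspan K) M \<and>
     (\<forall>k\<in>K. \<exists>c. adjoint_on (cspan K) M k = c *\<^sub>C k)"

definition extends_multiplier ::
  "'a::complex_inner set \<Rightarrow> 'a set \<Rightarrow> ('a \<Rightarrow> 'a) \<Rightarrow> ('a \<Rightarrow> 'a) \<Rightarrow> bool" where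
  "extends_multiplier K S M M\<^sub>J \<longleftrightarrow>
     (\<forall>v\<in>cspan S. adjoint_on (cspan K) M v = adjoint_on (cspan S) M\<^sub>J v)"

text \<open>
  Operator norm of the \<open>s \<times> t\<close> operator matrix \<open>F\<close>, acting from \<open>V\<^sup>t\<close> to \<open>V\<^sup>s\<close>. An element of \<open>V\<^sup>t\<close>
  is a sequence of which the entries with index below \<open>t\<close> count.
\<close>

definition matrix_opnorm ::
  "nat \<Rightarrow> nat \<Rightarrow> 'a::complex_inner set \<Rightarrow> (nat \<Rightarrow> nat \<Rightarrow> 'a \<Rightarrow> 'a) \<Rightarrow> real" where
  "matrix_opnorm s t V F =
     Sup {L2_set (\<lambda>i. norm (\<Sum>j<t. F i j (u j))) {..<s} | u :: nat \<Rightarrow> 'a.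
            (\<forall>j<t. u j \<in> V) \<and> L2_set (\<lambda>j. norm (u j)) {..<t} \<le> 1}"

definition complete_pick :: "'a::complex_inner set \<Rightarrow> bool" where
  "complete_pick K \<longleftrightarrow> irreducible_rkhs K \<and>
     (\<forall>S\<subseteq>K. \<forall>s\<ge>1. \<forall>t\<ge>1. \<forall>F. (\<forall>i<s. \<forall>j<t. multiplier S (F i j)) \<longrightarrow>
        (\<exists>G. (\<forall>i<s. \<forall>j<t. multiplier K (G i j) \<and> extends_multiplier K S (G i j) (F i j)) \<and>
             matrix_opnorm s t (cspan K) G = matrix_opnorm s t (cspan S) F))"


section \<open>Coherence and assembly of labelled families\<close>

text \<open>
  A family \<open>{J\<^sub>i}\<close> is given by labelled kernels \<open>j i r\<close>, \<open>r \<noteq> i\<close>: the kernel of \<open>J\<^sub>i\<close> with label \<open>r\<close>.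
  The values \<open>j i i\<close> are ignored.
\<close>

definition coherent :: "('i \<Rightarrow> 'i \<Rightarrow> 'a::complex_inner) \<Rightarrow> bool" where
  "coherent j \<longleftrightarrow> (\<forall>p q. p \<noteq> q \<longrightarrow> labelled_rescaling (- {p, q}) (j p) (j q))"

definition assembles_to ::
  "('i \<Rightarrow> 'i \<Rightarrow> 'a::complex_inner) \<Rightarrow> ('i \<Rightarrow> 'b::complex_inner) \<Rightarrow> bool"
  (infix "\<rightrightarrows>" 50) where
  "j \<rightrightarrows> h' \<longleftrightarrow> (\<forall>i. labelled_rescaling (- {i}) (j i) h')"


section \<open>The Gram matrix\<close>

text \<open>The index type \<open>4\<close> has the elements \<open>1, 2, 3, 4\<close>.\<close>

definition gram_matrix :: "real \<Rightarrow> complex ^ 4 ^ 4" where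
  "gram_matrix x =
    (let s = (1 - x) * sqrt x;
         a = complex_of_real x;
         z = a + \<i> * complex_of_real s;
         w = a - \<i> * complex_of_real s
     in vector [vector [1, a, a, z],
                vector [a, 1, w, a],
                vector [a, z, 1, a],
                vector [w, a, a, 1]])"

lemma vector_4_nth [simp]:
  "(vector [a, b, c, d] :: 'a::zero ^ 4) $ 1 = a"
  "(vector [a, b, c, d] :: 'a::zero ^ 4) $ 2 = b"
  "(vector [a, b, c, d] :: 'a::zero ^ 4) $ 3 = c"
  "(vector [a, b, c, d] :: 'a::zero ^ 4) $ 4 = d"
  by (simp_all add: vector_def)

text \<open>The space \<open>H\<^sub>x\<close> exists, already with kernels in \<open>complex ^ 4\<close>.\<close>

lemma gram_matrix_realizable:
  assumes x: "0 < x" "x < 1"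
  shows "\<exists>h :: 4 \<Rightarrow> complex ^ 4. inj h \<and> irreducible_rkhs (range h) \<and>
           (\<forall>i j. cinner (h i) (h j) = gram_matrix x $ i $ j)"
proof -
  define y where "y = sqrt x"
  define q where "q = sqrt (1 - x)"
  define p where "p = sqrt (1 + x)"
  have y2: "x = y\<^sup>2" and y0: "y > 0" using x by (simp_all add: y_def)
  have q2: "q\<^sup>2 = 1 - y\<^sup>2" and q0: "q > 0" using x by (simp_all add: q_def y2[symmetric])
  have p2: "p\<^sup>2 = 1 + y\<^sup>2" and p0: "p > 0" using x by (simp_all add: p_def y2[symmetric])
  have s: "(1 - x) * sqrt x = q\<^sup>2 * y" using y0 by (simp add: q2 y2)
  define r where "r = 1 / p"
  have pr: "p * r = 1" using p0 by (simp add: r_def)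
  define H :: "complex ^ 4 ^ 4" where
    "H = vector [vector [1, 0, 0, 0],
                 vector [of_real (y\<^sup>2), of_real (q * p), 0, 0],
                 vector [of_real (y\<^sup>2), Complex (y\<^sup>2 * q * r) (y * q * r), of_real q, 0],
                 vector [Complex (y\<^sup>2) (- (q\<^sup>2 * y)), Complex (y\<^sup>2 * q * r) (y ^ 3 * q * r),
                         Complex (y\<^sup>2 * q ^ 3 * r\<^sup>2) (2 * y ^ 3 * q * r\<^sup>2), of_real (q\<^sup>2 * p)]]"
  define h where "h = (\<lambda>i. H $ i)"
  have e: "h 1 = H $ 1" "h 2 = H $ 2" "h 3 = H $ 3" "h 4 = H $ 4" by (simp_all add: h_def)
  have p': "p \<noteq> 0" "q \<noteq> 0" using p0 q0 by auto
  have gram: "\<forall>i j. cinner (h i) (h j) = gram_matrix x $ i $ j"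
    unfolding forall_4 gram_matrix_def Let_def s
    apply (simp add: y2 e H_def cinner_vec_def sum_4 cinner_complex_def complex_eq_iff)
    apply (intro conjI)
    using p2 q2 pr apply -
    apply (algebra+)
    done
  have z: "c = (\<lambda>_. 0)" if "(\<Sum>i\<in>UNIV. c i *\<^sub>C h i) = 0" for c :: "4 \<Rightarrow> complex"
  proof -
    have *: "(\<Sum>i\<in>UNIV. c i *\<^sub>C h i) $ k = 0" for k
      using that by simp
    from *[of 4] *[of 3] *[of 2] *[of 1] have "c 4 = 0 \<and> c 3 = 0 \<and> c 2 = 0 \<and> c 1 = 0"
      using p' by (auto simp: sum_4 scaleC_vec_def scaleC_complex_def e H_def)
    then show ?thesis
      by (auto simp: fun_eq_iff forall_4)
  qed
  have inj: "inj h"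
  proof (rule injI, rule ccontr)
    fix i j assume ij: "h i = h j" "i \<noteq> j"
    let ?c = "\<lambda>k. if k = i then 1 else if k = j then - 1 else (0::complex)"
    have "(\<Sum>k\<in>UNIV. ?c k *\<^sub>C h k) = (\<Sum>k\<in>{i,j}. ?c k *\<^sub>C h k)"
      by (rule sum.mono_neutral_right) auto
    also have "\<dots> = 0" using ij by simp
    finally have "?c = (\<lambda>_. 0)" by (rule z)
    from fun_cong[OF this, of i] show False by simp
  qed
  have ind: "cindependent (range h)"
    unfolding complex_vector.dependent_finite[OF finite_imageI[OF finite]]
  proof safe
    fix u i assume u: "(\<Sum>v\<in>range h. u v *\<^sub>C v) = 0" "u (h i) \<noteq> 0"
    from u(1) have "(\<Sum>i\<in>UNIV. u (h i) *\<^sub>C h i) = 0"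
      by (simp add: sum.reindex[OF inj])
    from fun_cong[OF z[OF this], of i] u(2) show False by simp
  qed
  have "\<forall>i j. gram_matrix x $ i $ j \<noteq> 0"
    using x by (simp add: forall_4 gram_matrix_def Let_def complex_eq_iff)
  with gram inj ind show ?thesis
    by (intro exI[of _ h]) (simp add: irreducible_rkhs_def rkhs_def)
qed

end

theory Submission
  imports Defs
begin

text \<open>
  By duality, a matrix of multipliers on \<open>J\<close> with eigenvalues \<open>W\<^sub>k\<close> has norm at most \<open>c\<close> iff the Pick
  matrix \<open>\<langle>k, l\<rangle> (c\<^sup>2 - W\<^sub>k W\<^sub>l\<^sup>*)\<close> is positive semidefinite. Writing
  \<open>M\<^sub>n(k, l) = 1 - \<langle>k, n\<rangle> \<langle>n, l\<rangle> / (\<langle>k, l\<rangle> \<langle>n, n\<rangle>)\<close>, Parrott's lemma extends such a matrix to one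
  further kernel \<open>n\<close> as soon as \<open>M\<^sub>n\<close> is a Gram matrix, since \<open>\<langle>k, l\<rangle> M\<^sub>n(k, l)\<close> is the Gram matrix of
  the projections onto the complement of \<open>n\<close>. For three kernels \<open>M\<^sub>n\<close> is essentially a \<open>2 \<times> 2\<close>
  matrix, and for all triples of \<open>H\<^sub>x\<close> its determinant is a positive multiple of
  \<open>x\<^sup>4 (1 - x)\<^sup>2 (1 + x)\<close>; this gives (1).

  For (3), every entry of \<open>M\<^sub>1\<close> involves only three kernels, so it is invariant under the rescalings
  of the \<open>J\<^sub>i\<close>. Decompose \<open>M\<^sub>1\<close> on \<open>{1, 2, 3}\<close> as \<open>W\<^sub>k W\<^sub>l\<^sup>*\<close> with rows \<open>W\<^sub>k\<close> of length two. These rows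
  form a contractive multiplier, and a contractive extension to the fourth kernel forces
  \<open>M\<^sub>1(4, l) = V W\<^sub>l\<^sup>*\<close> and \<open>M\<^sub>1(4, 4) \<ge> V V\<^sup>*\<close>, so that the determinant of \<open>M\<^sub>1\<close> on \<open>{2, 3, 4}\<close>
  would be nonnegative; but it is a negative multiple of \<open>x\<^sup>4 (1 - x)\<^sup>3 (1 - x\<^sup>2) (1 + x)\<close>.
\<close>

section \<open>Positive semidefinite kernels\<close>

text \<open>Linear in \<open>a\<close> and conjugate linear in \<open>b\<close>, like
  \<open>cinner\<close>, so that for a Gram matrix \<open>B\<close> the value is the inner product
  of the combinations with coefficients \<open>a\<close> and \<open>b\<close>.\<close>

definition qform :: "'i set \<Rightarrow> ('i \<Rightarrow> 'i \<Rightarrow> complex) \<Rightarrow> ('i \<Rightarrow> complex) \<Rightarrow> ('i \<Rightarrow> complex) \<Rightarrow> complex" where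
  "qform I B a b = (\<Sum>k\<in>I. \<Sum>l\<in>I. a k * cnj (b l) * B k l)"

text \<open>Hermitian symmetry is a separate conjunct because nonnegativity of the real part alone
  does not imply it.\<close>

definition psd_on :: "'i set \<Rightarrow> ('i \<Rightarrow> 'i \<Rightarrow> complex) \<Rightarrow> bool" where
  "psd_on I B \<longleftrightarrow> (\<forall>k\<in>I. \<forall>l\<in>I. B l k = cnj (B k l)) \<and> (\<forall>a. 0 \<le> Re (qform I B a a))"

lemma psd_onI:
  assumes "\<And>k l. k \<in> I \<Longrightarrow> l \<in> I \<Longrightarrow> B l k = cnj (B k l)" "\<And>a. 0 \<le> Re (qform I B a a)"
  shows "psd_on I B"
  using assms unfolding psd_on_def by blast

lemma psd_onD:
  assumes "psd_on I B"
  shows "k \<in> I \<Longrightarrow> l \<in> I \<Longrightarrow> B l k = cnj (B k l)" "0 \<le> Re (qform I B a a)"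
  using assms unfolding psd_on_def by blast+

lemma qform_add:
  "qform I B (\<lambda>k. a k + b k) c = qform I B a c + qform I B b c"
  "qform I B c (\<lambda>k. a k + b k) = qform I B c a + qform I B c b"
  by (simp_all add: qform_def algebra_simps sum.distrib)

lemma qform_scale:
  "qform I B (\<lambda>k. t * a k) c = t * qform I B a c"
  "qform I B c (\<lambda>k. t * a k) = cnj t * qform I B c a"
  by (simp_all add: qform_def algebra_simps sum_distrib_left)

lemma qform_cong:
  assumes "\<And>k l. k \<in> I \<Longrightarrow> l \<in> I \<Longrightarrow> B k l = C k l" 
    "\<And>k. k \<in> I \<Longrightarrow> a k = a' k" "\<And>k. k \<in> I \<Longrightarrow> b k = b' k"
  shows "qform I B a b = qform I C a' b'"
  unfolding qform_def using assms by (intro sum.cong) auto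

lemma psd_on_cong:
  assumes "psd_on I B" "\<And>k l. k \<in> I \<Longrightarrow> l \<in> I \<Longrightarrow> B k l = C k l" 
  shows "psd_on I C"
proof (rule psd_onI)
  show "C l k = cnj (C k l)" if "k \<in> I" "l \<in> I" for k l
    using psd_onD(1)[OF assms(1) that] unfolding assms(2)[OF that] assms(2)[OF that(2) that(1)] .
  show "0 \<le> Re (qform I C a a)" for a
  proof -
    have "qform I B a a = qform I C a a" by (rule qform_cong) (simp_all add: assms(2))
    with psd_onD(2)[OF assms(1), of a] show ?thesis by simp
  qed
qed

lemma qform_mono_neutral:
  assumes "finite I" "J \<subseteq> I" "\<And>k. k \<in> I - J \<Longrightarrow> a k = 0" "\<And>k. k \<in> I - J \<Longrightarrow> b k = 0"
  shows "qform I B a b = qform J B a b"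
proof -
  have "(\<Sum>l\<in>I. a k * cnj (b l) * B k l) = (\<Sum>l\<in>J. a k * cnj (b l) * B k l)" for k
    using assms by (intro sum.mono_neutral_right) auto
  moreover have "(\<Sum>k\<in>I. \<Sum>l\<in>J. a k * cnj (b l) * B k l) = (\<Sum>k\<in>J. \<Sum>l\<in>J. a k * cnj (b l) * B k l)"
    using assms by (intro sum.mono_neutral_right) auto
  ultimately show ?thesis by (simp add: qform_def)
qed

lemma psd_on_subset:
  assumes "psd_on I B" "finite I" "J \<subseteq> I"
  shows "psd_on J B"
proof (rule psd_onI)
  show "B l k = cnj (B k l)" if "k \<in> J" "l \<in> J" for k l
    using psd_onD(1)[OF assms(1)] assms(3) that by blast
  show "0 \<le> Re (qform J B a a)" for a
  proof -
    let ?a = "\<lambda>k. if k \<in> J then a k else 0"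
    have "qform I B ?a ?a = qform J B ?a ?a"
      by (rule qform_mono_neutral) (use assms in auto)
    also have "\<dots> = qform J B a a" by (rule qform_cong) auto
    finally show ?thesis using psd_onD(2)[OF assms(1)] by metis
  qed
qed

section \<open>Null vectors, projections and Schur complements\<close>

lemma qform_commute:
  assumes "\<And>k l. k \<in> I \<Longrightarrow> l \<in> I \<Longrightarrow> B l k = cnj (B k l)"
  shows "qform I B b a = cnj (qform I B a b)"
proof -
  have "qform I B b a = (\<Sum>k\<in>I. \<Sum>l\<in>I. b l * cnj (a k) * B l k)"
    unfolding qform_def by (rule sum.swap)
  also have "\<dots> = (\<Sum>k\<in>I. \<Sum>l\<in>I. b l * cnj (a k) * cnj (B k l))"
    by (intro sum.cong refl arg_cong2[where f = "(*)"] assms)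
  finally show ?thesis by (simp add: qform_def mult_ac)
qed

text \<open>Degenerate Cauchy-Schwarz: if \<open>?q\<close> were nonzero, moving \<open>b\<close>
  along the null vector \<open>a\<close> would change the form affinely with nonzero slope and so
  make it negative somewhere.\<close>

lemma psd_on_null:
  assumes psd: "psd_on I B" and 0: "Re (qform I B a a) = 0"
  shows "qform I B a b = 0"
proof (rule ccontr)
  let ?q = "qform I B a b"
  assume q: "?q \<noteq> 0"
  define N where "N = Re (qform I B b b)"
  have comm: "qform I B b a = cnj ?q" by (rule qform_commute) (rule psd_onD(1)[OF psd])
  have "0 \<le> N + 2 * R * (cmod ?q)\<^sup>2" for R :: real
  proof -
    \<comment> \<open>The factor \<open>cnj ?q\<close> makes each of the two cross terms real, equal
      to \<open>R * (cmod ?q)^2\<close>.\<close>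
    let ?t = "of_real R * cnj ?q"
    let ?v = "\<lambda>k. b k + ?t * a k"
    have "0 \<le> Re (qform I B ?v ?v)" using psd by (rule psd_onD)
    also have "qform I B ?v ?v = qform I B b b + ?t * ?q + cnj (?t * ?q) + ?t * cnj ?t * qform I B a a"
      by (simp only: qform_add qform_scale comm) (simp add: algebra_simps)
    also have "?t * ?q = of_real (R * (cmod ?q)\<^sup>2)"
      by (metis complex_norm_square mult.commute mult.left_commute of_real_mult)
    also have "?t * cnj ?t = of_real ((cmod ?t)\<^sup>2)"
      by (simp only: complex_norm_square)
    finally show ?thesis by (simp add: N_def 0)
  qed
  \<comment> \<open>For this \<open>R\<close> the bound reads 0 \<le> -1.\<close>
  from this[of "- (N + 1) / (2 * (cmod ?q)\<^sup>2)"] q show False by (simp add: field_simps)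
qed

text \<open>The \<open>b r\<close> are coordinates of the orthogonal projection of \<open>p\<close>
  onto the span of \<open>I\<close>; they exist even if the block on \<open>I\<close> is singular.
  The induction is Gram-Schmidt: the residual of the new index \<open>r\<close> corrects the
  projection of \<open>p\<close>.\<close>

lemma psd_on_projection:
  assumes "finite I" "p \<notin> I" "psd_on (insert p I) B"
  shows "\<exists>b. \<forall>q\<in>I. B p q = (\<Sum>r\<in>I. b r * B r q)"
  using assms
proof (induction I arbitrary: p rule: finite_induct)
  case empty
  then show ?case by simp
next
  case (insert r I)
  let ?U = "insert p (insert r I)"
  note psd = insert.prems(2)
  have fU: "finite ?U" using insert by simp
  have "psd_on (insert p I) B" "psd_on (insert r I) B"
    by (rule psd_on_subset[OF psd fU], blast)+
  then have "\<exists>b. \<forall>q\<in>I. B p q = (\<Sum>r\<in>I. b r * B r q)" "\<exists>c. \<forall>q\<in>I. B r q = (\<Sum>x\<in>I. c x * B x q)"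
    using insert.IH insert.hyps insert.prems(1) by blast+
  then obtain b c where b: "\<And>q. q \<in> I \<Longrightarrow> B p q = (\<Sum>x\<in>I. b x * B x q)"
    and c: "\<And>q. q \<in> I \<Longrightarrow> B r q = (\<Sum>x\<in>I. c x * B x q)"
    by blast
  define f where "f q = B p q - (\<Sum>x\<in>I. b x * B x q)" for q
  define e where "e q = B r q - (\<Sum>x\<in>I. c x * B x q)" for q
  \<comment> \<open>Coordinate vectors of the residuals of \<open>p\<close> and \<open>r\<close>;
    the form pairs them with a vector through \<open>f\<close> and \<open>e\<close>.\<close>
  define vf where "vf k = (if k = p then 1 else if k \<in> I then - b k else 0)" for k
  define ve where "ve k = (if k = r then 1 else if k \<in> I then - c k else 0)" for k
  have [simp]: "p \<noteq> r" "p \<notin> I" "r \<notin> I" "finite I" "r \<noteq> p" using insert by auto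
  have qf: "qform ?U B vf v = (\<Sum>l\<in>?U. cnj (v l) * f l)" for v
  proof -
    have "qform ?U B vf v = (\<Sum>l\<in>?U. \<Sum>k\<in>?U. vf k * cnj (v l) * B k l)"
      unfolding qform_def by (rule sum.swap)
    also have "\<dots> = (\<Sum>l\<in>?U. cnj (v l) * f l)"
    proof (rule sum.cong)
      fix l
      have "(\<Sum>k\<in>?U. vf k * cnj (v l) * B k l) = cnj (v l) * B p l + (\<Sum>k\<in>I. vf k * cnj (v l) * B k l)"
        by (simp add: vf_def)
      also have "(\<Sum>k\<in>I. vf k * cnj (v l) * B k l) = (\<Sum>k\<in>I. - (cnj (v l) * (b k * B k l)))"
        by (rule sum.cong) (auto simp: vf_def)
      finally show "(\<Sum>k\<in>?U. vf k * cnj (v l) * B k l) = cnj (v l) * f l"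
        by (simp add: f_def sum_negf sum_distrib_left algebra_simps)
    qed simp
    finally show ?thesis .
  qed
  have qe: "qform ?U B ve v = (\<Sum>l\<in>?U. cnj (v l) * e l)" for v
  proof -
    have "qform ?U B ve v = (\<Sum>l\<in>?U. \<Sum>k\<in>?U. ve k * cnj (v l) * B k l)"
      unfolding qform_def by (rule sum.swap)
    also have "\<dots> = (\<Sum>l\<in>?U. cnj (v l) * e l)"
    proof (rule sum.cong)
      fix l
      have "(\<Sum>k\<in>?U. ve k * cnj (v l) * B k l) = cnj (v l) * B r l + (\<Sum>k\<in>I. ve k * cnj (v l) * B k l)"
        by (simp add: ve_def)
      also have "(\<Sum>k\<in>I. ve k * cnj (v l) * B k l) = (\<Sum>k\<in>I. - (cnj (v l) * (c k * B k l)))"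
        by (rule sum.cong) (auto simp: ve_def)
      finally show "(\<Sum>k\<in>?U. ve k * cnj (v l) * B k l) = cnj (v l) * e l"
        by (simp add: e_def sum_negf sum_distrib_left algebra_simps)
    qed simp
    finally show ?thesis .
  qed
  have e0: "e q = 0" and f0: "f q = 0" if "q \<in> I" for q
    using b c that by (simp_all add: e_def f_def)
  have fe: "qform ?U B vf ve = f r" by (simp add: qf f0 ve_def)
  have ee: "qform ?U B ve ve = e r" by (simp add: qe e0 ve_def)
  have "qform ?U B vf ve = cnj (qform ?U B ve vf)"
    by (rule qform_commute) (rule psd_onD(1)[OF psd])
  \<comment> \<open>If the residual of \<open>r\<close> is a null vector, \<open>f r\<close>
    vanishes too; then \<open>f r / e r\<close> is \<open>0\<close> by the convention for division,
    and no correction is made.\<close>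
  then have er: "e r = 0 \<Longrightarrow> f r = 0"
    using psd_on_null[OF psd, of ve vf] fe ee by simp
  define d where "d k = (if k = r then f r / e r else b k - f r / e r * c k)" for k
  have "B p q = (\<Sum>k\<in>insert r I. d k * B k q)" if q: "q \<in> insert r I" for q
  proof -
    have "(\<Sum>k\<in>insert r I. d k * B k q) = d r * B r q + (\<Sum>k\<in>I. d k * B k q)" by simp
    also have "(\<Sum>k\<in>I. d k * B k q) = (\<Sum>k\<in>I. b k * B k q - f r / e r * (c k * B k q))"
      by (rule sum.cong) (auto simp: d_def algebra_simps)
    also have "\<dots> = (B p q - f q) - f r / e r * (B r q - e q)"
      by (simp add: sum_subtractf sum_distrib_left f_def e_def sum_divide_distrib)
    finally have "(\<Sum>k\<in>insert r I. d k * B k q) = B p q - f q + d r * e q"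
      by (simp only: d_def) (simp add: algebra_simps)
    with q e0 f0 er show ?thesis by (auto simp: d_def)
  qed
  then show ?case by blast
qed

lemma qform_insert:
  assumes "finite I" "p \<notin> I"
  shows "qform (insert p I) B a b = a p * cnj (b p) * B p p + a p * (\<Sum>l\<in>I. cnj (b l) * B p l)
    + cnj (b p) * (\<Sum>k\<in>I. a k * B k p) + qform I B a b"
  using assms by (simp add: qform_def sum.distrib sum_distrib_left algebra_simps)

text \<open>Completing the square: \<open>p\<close> splits into a combination of \<open>I\<close>
  with coordinates \<open>b\<close> and a residual orthogonal to \<open>I\<close>, on which the form
  takes the Schur complement \<open>B p p - qform I B b b\<close> as its value.\<close>

lemma qform_insert_projection:
  assumes I: "finite I" "p \<notin> I"
    and herm: "\<And>k l. k \<in> insert p I \<Longrightarrow> l \<in> insert p I \<Longrightarrow> B l k = cnj (B k l)"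
    and b: "\<And>q. q \<in> I \<Longrightarrow> B p q = (\<Sum>r\<in>I. b r * B r q)"
  shows "qform (insert p I) B x x =
    qform I B (\<lambda>k. x k + x p * b k) (\<lambda>k. x k + x p * b k) + x p * cnj (x p) * (B p p - qform I B b b)"
proof -
  have *: "(\<Sum>l\<in>I. cnj (y l) * B p l) = qform I B b y" for y
  proof -
    have "(\<Sum>l\<in>I. cnj (y l) * B p l) = (\<Sum>l\<in>I. \<Sum>k\<in>I. b k * cnj (y l) * B k l)"
      by (rule sum.cong) (auto simp: b sum_distrib_left mult_ac)
    also have "\<dots> = qform I B b y" unfolding qform_def by (rule sum.swap)
    finally show ?thesis .
  qed
  have c: "qform I B y b = cnj (qform I B b y)" for y
    by (rule qform_commute) (rule herm, auto)
  have **: "(\<Sum>l\<in>I. y l * B l p) = qform I B y b" for y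
  proof -
    have "(\<Sum>l\<in>I. y l * B l p) = cnj (\<Sum>l\<in>I. cnj (y l) * B p l)"
      unfolding cnj_sum
    proof (rule sum.cong)
      fix l assume "l \<in> I"
      then have "B l p = cnj (B p l)" by (intro herm) auto
      then show "y l * B l p = cnj (cnj (y l) * B p l)" by simp
    qed simp
    then show ?thesis by (simp add: * c)
  qed
  show ?thesis
    by (simp only: qform_insert[OF I] * ** qform_add qform_scale) (simp add: algebra_simps)
qed

text \<open>
  The one-column case of Parrott's lemma: composing the functionals with the \<open>Q\<close>-orthogonal
  projection onto the span of \<open>I\<close> does not increase them.
\<close>

lemma psd_on_extend_insert:
  fixes t :: nat
  assumes I: "finite I" "p \<notin> I" and Q: "psd_on (insert p I) Q"
    and R: "psd_on I (\<lambda>k l. Q k l - (\<Sum>j<t. a j k * cnj (a j l)))"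
  shows "\<exists>v. psd_on (insert p I)
    (\<lambda>k l. Q k l - (\<Sum>j<t. ((a j)(p := v j)) k * cnj (((a j)(p := v j)) l)))"
proof -
  obtain b where b: "\<And>q. q \<in> I \<Longrightarrow> Q p q = (\<Sum>r\<in>I. b r * Q r q)"
    using psd_on_projection[OF I Q] by blast
  define v where "v j = (\<Sum>r\<in>I. b r * a j r)" for j :: nat
  define a' where "a' j = (a j)(p := v j)" for j
  have a'p: "a' j p = v j" and a'I: "k \<in> I \<Longrightarrow> a' j k = a j k" for j k
    using I by (auto simp: a'_def)
  define S where "S k l = Q k l - (\<Sum>j<t. a' j k * cnj (a' j l))" for k l
  have SI: "psd_on I S"
    by (rule psd_on_cong[OF R]) (simp add: S_def a'I)
  have herm: "S l k = cnj (S k l)" if "k \<in> insert p I" "l \<in> insert p I" for k l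
    unfolding S_def psd_onD(1)[OF Q that] by (simp add: mult_ac)
  have Sb: "S p q = (\<Sum>r\<in>I. b r * S r q)" if q: "q \<in> I" for q
  proof -
    have "(\<Sum>r\<in>I. b r * S r q) = (\<Sum>r\<in>I. b r * Q r q) - (\<Sum>r\<in>I. \<Sum>j<t. b r * a j r * cnj (a j q))"
      unfolding sum_subtractf[symmetric]
      by (rule sum.cong) (auto simp: S_def a'I q algebra_simps sum_distrib_left)
    also have "(\<Sum>r\<in>I. \<Sum>j<t. b r * a j r * cnj (a j q)) = (\<Sum>j<t. v j * cnj (a j q))"
      by (subst sum.swap) (simp add: v_def sum_distrib_right)
    finally show ?thesis by (simp add: S_def a'p a'I q b)
  qed
  have vv: "(\<Sum>j<t. v j * cnj (v j)) = (\<Sum>k\<in>I. \<Sum>l\<in>I. b k * cnj (b l) * (\<Sum>j<t. a j k * cnj (a j l)))"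
  proof -
    have "(\<Sum>j<t. v j * cnj (v j)) = (\<Sum>j<t. \<Sum>k\<in>I. \<Sum>l\<in>I. b k * cnj (b l) * (a j k * cnj (a j l)))"
      by (simp add: v_def sum_product mult_ac)
    also have "\<dots> = (\<Sum>k\<in>I. \<Sum>j<t. \<Sum>l\<in>I. b k * cnj (b l) * (a j k * cnj (a j l)))"
      by (rule sum.swap)
    also have "\<dots> = (\<Sum>k\<in>I. \<Sum>l\<in>I. \<Sum>j<t. b k * cnj (b l) * (a j k * cnj (a j l)))"
      by (intro sum.cong refl sum.swap)
    finally show ?thesis by (simp add: sum_distrib_left)
  qed
  have "qform I S b b = qform I Q b b - (\<Sum>k\<in>I. \<Sum>l\<in>I. b k * cnj (b l) * (\<Sum>j<t. a j k * cnj (a j l)))"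
    unfolding qform_def sum_subtractf[symmetric]
    by (intro sum.cong) (auto simp: S_def a'I algebra_simps)
  \<comment> \<open>The choice of \<open>v\<close> subtracts the same sum of
    \<open>v j * cnj (v j)\<close> from both terms, so passing from \<open>Q\<close> to
    \<open>S\<close> leaves the Schur complement unchanged.\<close>
  then have Sbb: "S p p - qform I S b b = Q p p - qform I Q b b"
    by (simp add: S_def a'p vv)
  \<comment> \<open>The residual of \<open>p\<close>: its component along \<open>I\<close> is zero,
    so its \<open>Q\<close>-value is exactly the Schur complement, which is therefore
    nonnegative.\<close>
  let ?d = "\<lambda>k. if k = p then 1 else - b k"
  have "qform I Q (\<lambda>k. ?d k + ?d p * b k) (\<lambda>k. ?d k + ?d p * b k) = qform I Q (\<lambda>k. 0) (\<lambda>k. 0)"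
    by (rule qform_cong) (use I in auto)
  then have "qform (insert p I) Q ?d ?d = Q p p - qform I Q b b"
    using qform_insert_projection[OF I psd_onD(1)[OF Q] b, of ?d] by (simp add: qform_def)
  then have pos: "0 \<le> Re (S p p - qform I S b b)"
    using psd_onD(2)[OF Q, of ?d] by (simp add: Sbb)
  have "psd_on (insert p I) S"
  proof (rule psd_onI[OF herm])
    fix x
    have "Re (x p * cnj (x p) * (S p p - qform I S b b)) = (cmod (x p))\<^sup>2 * Re (S p p - qform I S b b)"
      by (simp only: complex_norm_square[symmetric] Re_complex_of_real Im_complex_of_real times_complex.sel of_real_power[symmetric])

    with pos have "0 \<le> Re (x p * cnj (x p) * (S p p - qform I S b b))" by simp
    then show "0 \<le> Re (qform (insert p I) S x x)"
      using qform_insert_projection[OF I herm Sb, of x] psd_onD(2)[OF SI] by simp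
  qed auto
  then show ?thesis unfolding S_def a'_def by blast
qed

lemma psd_on_extend:
  fixes t :: nat
  assumes J: "finite J" and I: "finite I" and Q: "psd_on (I \<union> J) Q"
    and R: "psd_on I (\<lambda>k l. Q k l - (\<Sum>j<t. a j k * cnj (a j l)))"
  shows "\<exists>a'. (\<forall>j. \<forall>k\<in>I. a' j k = a j k) \<and>
    psd_on (I \<union> J) (\<lambda>k l. Q k l - (\<Sum>j<t. a' j k * cnj (a' j l)))"
  using J Q
proof (induction J rule: finite_induct)
  case empty
  then show ?case using R by auto
next
  case (insert p J)
  have "psd_on (I \<union> J) Q"
    by (rule psd_on_subset[OF insert.prems]) (use insert I in auto)
  then obtain a' where a': "\<And>j k. k \<in> I \<Longrightarrow> a' j k = a j k"
    "psd_on (I \<union> J) (\<lambda>k l. Q k l - (\<Sum>j<t. a' j k * cnj (a' j l)))"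
    using insert.IH by blast
  show ?case
  proof (cases "p \<in> I")
    case True
    then have "I \<union> insert p J = I \<union> J" by auto
    then show ?thesis using a' by auto
  next
    case False
    then have "finite (I \<union> J)" "p \<notin> I \<union> J" using insert I by auto
    from psd_on_extend_insert[OF this _ a'(2)] insert.prems obtain v where
      "psd_on (insert p (I \<union> J))
        (\<lambda>k l. Q k l - (\<Sum>j<t. ((a' j)(p := v j)) k * cnj (((a' j)(p := v j)) l)))" by auto
    moreover have "((a' j)(p := v j)) k = a j k" if "k \<in> I" for j k
      using a'(1)[OF that] False that by auto
    ultimately show ?thesis by (intro exI[of _ "\<lambda>j. (a' j)(p := v j)"]) simp_all
  qed
qed

section \<open>Sums, Schur products and Gram matrices\<close>

lemma psd_on_add:
  assumes "psd_on I B" "psd_on I C"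
  shows "psd_on I (\<lambda>k l. B k l + C k l)"
proof (rule psd_onI)
  show "B l k + C l k = cnj (B k l + C k l)" if "k \<in> I" "l \<in> I" for k l
    unfolding psd_onD(1)[OF assms(1) that] psd_onD(1)[OF assms(2) that] by simp
  have "qform I (\<lambda>k l. B k l + C k l) a a = qform I B a a + qform I C a a" for a
    by (simp add: qform_def algebra_simps sum.distrib)
  then show "0 \<le> Re (qform I (\<lambda>k l. B k l + C k l) a a)" for a
    using psd_onD(2)[OF assms(1), of a] psd_onD(2)[OF assms(2), of a] by simp
qed

text \<open>A Schur product with a rank one matrix is a congruence: it replaces the vector
  \<open>a\<close> by \<open>\<lambda>k. a k * m k r\<close>. A Gram matrix is a sum of such rank
  one matrices.\<close>

lemma psd_on_gram_times:
  assumes "psd_on I B"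
  shows "psd_on I (\<lambda>k l. (\<Sum>r<R::nat. m k r * cnj (m l r)) * B k l)"
proof (rule psd_onI)
  show "(\<Sum>r<R. m l r * cnj (m k r)) * B l k = cnj ((\<Sum>r<R. m k r * cnj (m l r)) * B k l)"
    if "k \<in> I" "l \<in> I" for k l
    unfolding psd_onD(1)[OF assms that] by (simp add: mult_ac)
  show "0 \<le> Re (qform I (\<lambda>k l. (\<Sum>r<R. m k r * cnj (m l r)) * B k l) a a)" for a
  proof -
    have "qform I (\<lambda>k l. (\<Sum>r<R. m k r * cnj (m l r)) * B k l) a a =
      (\<Sum>k\<in>I. \<Sum>l\<in>I. \<Sum>r<R. (a k * m k r) * cnj (a l * m l r) * B k l)"
      unfolding qform_def
      by (intro sum.cong refl) (simp add: sum_distrib_left sum_distrib_right mult_ac)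
    also have "\<dots> = (\<Sum>k\<in>I. \<Sum>r<R. \<Sum>l\<in>I. (a k * m k r) * cnj (a l * m l r) * B k l)"
      by (intro sum.cong refl sum.swap)
    also have "\<dots> = (\<Sum>r<R. qform I B (\<lambda>k. a k * m k r) (\<lambda>k. a k * m k r))"
      unfolding qform_def by (rule sum.swap)
    finally show ?thesis
      using psd_onD(2)[OF assms] by (simp add: sum_nonneg)
  qed
qed

lemma psd_on_1: "psd_on I (\<lambda>_ _. 1)"
proof (rule psd_onI)
  fix a :: "'a \<Rightarrow> complex"
  have "qform I (\<lambda>_ _. 1) a a = of_real ((cmod (\<Sum>k\<in>I. a k))\<^sup>2)"
    unfolding complex_norm_square by (simp add: qform_def sum_product)
  then show "0 \<le> Re (qform I (\<lambda>_ _. 1) a a)" by simp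
qed simp

lemma psd_on_gram: "psd_on I (\<lambda>k l. \<Sum>r<R::nat. m k r * cnj (m l r))"
  using psd_on_gram_times[OF psd_on_1, where I = I and R = R and m = m] by simp

lemma psd_on_zero_extension:
  assumes "psd_on J B" "finite I" "J \<subseteq> I"
    and 0: "\<And>k l. k \<in> I \<Longrightarrow> l \<in> I \<Longrightarrow> k \<notin> J \<or> l \<notin> J \<Longrightarrow> B k l = 0"
  shows "psd_on I B"
proof (rule psd_onI)
  show "B l k = cnj (B k l)" if "k \<in> I" "l \<in> I" for k l
  proof (cases "k \<in> J \<and> l \<in> J")
    case True
    then show ?thesis by (intro psd_onD(1)[OF assms(1)]) auto
  next
    case False
    then have "B k l = 0" "B l k = 0" using that 0 by blast+
    then show ?thesis by simp
  qed
  show "0 \<le> Re (qform I B a a)" for a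
  proof -
    let ?a = "\<lambda>k. if k \<in> J then a k else 0"
    have "qform I B a a = qform I B ?a ?a"
      unfolding qform_def using 0 by (intro sum.cong refl) auto
    also have "\<dots> = qform J B ?a ?a"
      by (rule qform_mono_neutral) (use assms in auto)
    finally show ?thesis using psd_onD(2)[OF assms(1)] by metis
  qed
qed

lemma qform_delta:
  assumes "finite I" "p \<in> I" "q \<in> I"
  shows "qform I B (\<lambda>k. if k = p then 1 else 0) (\<lambda>k. if k = q then 1 else 0) = B p q"
proof -
  have "qform I B (\<lambda>k. if k = p then 1 else 0) (\<lambda>k. if k = q then 1 else 0) = 
    (\<Sum>k\<in>I. if k = p then B p q else 0)"
    unfolding qform_def
  proof (intro sum.cong refl)
    fix k
    have "(\<Sum>l\<in>I. (if k = p then 1 else 0) * cnj (if l = q then 1 else 0) * B k l) =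
      (\<Sum>l\<in>I. if l = q then (if k = p then B p q else 0) else 0)"
      by (rule sum.cong) auto
    then show "(\<Sum>l\<in>I. (if k = p then 1 else 0) * cnj (if l = q then 1 else 0) * B k l) =
      (if k = p then B p q else 0)" using assms by simp
  qed
  then show ?thesis using assms by simp
qed

section \<open>Adjoints and operator norms\<close>

lemma cinner_add_right: "cinner x (y + z) = cinner x y + cinner x z"
  by (metis cinner_add_left cinner_commute complex_cnj_add)

lemma cinner_scaleC_right: "cinner x (a *\<^sub>C y) = cnj a * cinner x y"
  by (metis cinner_scaleC_left cinner_commute complex_cnj_mult)

lemma cinner_zero_left [simp]: "cinner 0 x = 0"
  by (metis add_cancel_right_right cinner_add_left)

lemma cinner_zero_right [simp]: "cinner x 0 = 0"
  by (metis add_cancel_right_right cinner_add_right)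

lemma cinner_diff_right: "cinner x (y - z) = cinner x y - cinner x z"
  by (metis add_diff_cancel_right' cinner_add_right diff_add_cancel)

lemma cinner_sum_left: "cinner (\<Sum>i\<in>I. f i) y = (\<Sum>i\<in>I. cinner (f i) y)"
  by (induction I rule: infinite_finite_induct) (auto simp: cinner_add_left)

lemma cinner_sum_right: "cinner y (\<Sum>i\<in>I. f i) = (\<Sum>i\<in>I. cinner y (f i))"
  by (induction I rule: infinite_finite_induct) (auto simp: cinner_add_right)

lemma cinner_self: "cinner x x = complex_of_real ((norm x)\<^sup>2)"
proof (rule complex_eqI)
  show "Re (cinner x x) = Re (complex_of_real ((norm x)\<^sup>2))"
    by (simp add: inner_eq_Re_cinner[symmetric] dot_square_norm)
  show "Im (cinner x x) = Im (complex_of_real ((norm x)\<^sup>2))"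
    using arg_cong[OF cinner_commute[of x x], of Im] by simp
qed

lemma cinner_self_eq_0 [simp]: "cinner x x = 0 \<longleftrightarrow> x = 0"
  by (simp add: cinner_self)

lemma norm_scaleC:
  fixes x :: "'a::complex_inner"
  shows "norm (a *\<^sub>C x) = cmod a * norm x"
proof -
  have "complex_of_real ((norm (a *\<^sub>C x))\<^sup>2) = a * cnj a * cinner x x"
    by (simp only: cinner_self[symmetric] cinner_scaleC_left cinner_scaleC_right mult_ac)
  also have "\<dots> = complex_of_real ((cmod a * norm x)\<^sup>2)"
    by (simp only: cinner_self power_mult_distrib of_real_mult complex_norm_square)
  finally have "complex_of_real ((norm (a *\<^sub>C x))\<^sup>2) = complex_of_real ((cmod a * norm x)\<^sup>2)" .
  then have "(norm (a *\<^sub>C x))\<^sup>2 = (cmod a * norm x)\<^sup>2" by (simp only: of_real_eq_iff)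
  then show ?thesis by (rule power2_eq_imp_eq) auto
qed

lemma cinner_le_norm: "cmod (cinner x y) \<le> norm x * norm y"
proof (cases "cinner x y = 0")
  case False
  \<comment> \<open>The unit phase that turns \<open>cinner x y\<close> into its modulus; it reduces
    the claim to Cauchy-Schwarz for the real inner product.\<close>
  define a where "a = cnj (cinner x y) / of_real (cmod (cinner x y))"
  have "cmod a = 1" using False by (simp add: a_def norm_divide)
  have "a * cinner x y = of_real ((cmod (cinner x y))\<^sup>2) / of_real (cmod (cinner x y))"
    by (simp only: a_def complex_norm_square) simp
  then have "Re (a * cinner x y) = cmod (cinner x y)"
    using False by (simp add: power2_eq_square)
  then have "cmod (cinner x y) = inner (a *\<^sub>C x) y"
    by (simp add: inner_eq_Re_cinner cinner_scaleC_left)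
  also have "\<dots> \<le> norm (a *\<^sub>C x) * norm y" by (rule norm_cauchy_schwarz)
  finally show ?thesis using \<open>cmod a = 1\<close> by (simp add: norm_scaleC)
qed simp

section \<open>Functionals, adjoints and multipliers on finite dimensional spans\<close>

definition linear_functional_on :: "'a::complex_inner set \<Rightarrow> ('a \<Rightarrow> complex) \<Rightarrow> bool" where
  "linear_functional_on V f \<longleftrightarrow> (\<forall>u\<in>V. \<forall>v\<in>V. f (u + v) = f u + f v) \<and>
     (\<forall>a. \<forall>u\<in>V. f (a *\<^sub>C u) = a * f u)"

text \<open>Gram-Schmidt by induction on the spanning set, which need not be independent: the
  representing vector on the smaller span is corrected along the part \<open>e\<close> of
  \<open>b\<close> orthogonal to that span.\<close>

lemma riesz_representation:
  assumes "finite B" "linear_functional_on (cspan B) f"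
  shows "\<exists>w\<in>cspan B. \<forall>u\<in>cspan B. f u = cinner u w"
  using assms
proof (induction B arbitrary: f rule: finite_induct)
  case empty
  then have "f (0 *\<^sub>C 0) = 0 * f 0"
    unfolding linear_functional_on_def by (metis complex_vector.span_zero)
  then show ?case by (simp)
next
  case (insert b B)
  let ?V = "cspan B" and ?U = "cspan (insert b B)"
  have sub: "?V \<subseteq> ?U" by (intro complex_vector.span_mono) auto
  have lin: "linear_functional_on ?V f" "linear_functional_on ?V (\<lambda>u. cinner u b)"
    using insert.prems sub unfolding linear_functional_on_def
    by (blast, simp add: cinner_add_left cinner_scaleC_left)
  obtain w where w: "w \<in> ?V" "\<And>u. u \<in> ?V \<Longrightarrow> f u = cinner u w"
    using insert.IH[OF lin(1)] by blast
  obtain p where p: "p \<in> ?V" "\<And>u. u \<in> ?V \<Longrightarrow> cinner u b = cinner u p"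
    using insert.IH[OF lin(2)] by blast
  define e where "e = b - p"
  have eU: "e \<in> ?U" unfolding e_def
    using p(1) sub by (intro complex_vector.span_diff) (auto intro: complex_vector.span_base)
  have ort: "cinner u e = 0" if "u \<in> ?V" for u
    using p(2)[OF that] by (simp add: e_def cinner_diff_right)
  \<comment> \<open>If \<open>b\<close> already lies in the smaller span, then \<open>e\<close> is
    zero, the correction vanishes and \<open>f e = 0\<close> keeps the formula right.\<close>
  define w' where "w' = w + (cnj (f e) / cinner e e) *\<^sub>C e"
  have "w' \<in> ?U"
    unfolding w'_def using w sub eU by (intro complex_vector.span_add complex_vector.span_scale) auto
  moreover have "f u = cinner u w'" if u: "u \<in> ?U" for u
  proof -
    obtain a where a: "u - a *\<^sub>C b \<in> ?V" using complex_vector.span_breakdown_eq u by blast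
    define v where "v = u - a *\<^sub>C b + a *\<^sub>C p"
    have v: "v \<in> ?V" unfolding v_def using a p by (intro complex_vector.span_add complex_vector.span_scale)
    have uv: "u = v + a *\<^sub>C e"
      by (simp add: v_def e_def complex_vector.scale_right_diff_distrib)
    have "a *\<^sub>C e \<in> ?U" using eU by (rule complex_vector.span_scale)
    then have "f u = f v + a * f e"
      using insert.prems v sub eU unfolding linear_functional_on_def uv by auto
    moreover have "f e = 0" if "e = 0"
      using insert.prems eU that unfolding linear_functional_on_def
      by (metis complex_vector.scale_zero_left mult_zero_left)
    moreover have "cinner e w = 0" using ort[OF w(1)] cinner_commute[of e w] by simp
    moreover have "cnj (cinner e e) = cinner e e" by (metis cinner_commute)
    ultimately show ?thesis
      by (auto simp: uv w'_def cinner_add_left cinner_add_right cinner_scaleC_left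
          cinner_scaleC_right w(2)[OF v] ort[OF v])
  qed
  ultimately show ?case by blast
qed

lemma linear_operator_onD:
  assumes "linear_operator_on V M"
  shows "u \<in> V \<Longrightarrow> M u \<in> V" "u \<in> V \<Longrightarrow> v \<in> V \<Longrightarrow> M (u + v) = M u + M v"
    "u \<in> V \<Longrightarrow> M (a *\<^sub>C u) = a *\<^sub>C M u"
  using assms unfolding linear_operator_on_def by blast+

lemma linear_operator_on_sum:
  assumes M: "linear_operator_on (cspan B) M" and f: "\<And>i. i \<in> I \<Longrightarrow> f i \<in> cspan B"
  shows "M (\<Sum>i\<in>I. a i *\<^sub>C f i) = (\<Sum>i\<in>I. a i *\<^sub>C M (f i))"
proof -
  have 0: "M 0 = 0"
    using linear_operator_onD(3)[OF M complex_vector.span_zero, of 0] by simp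
  show ?thesis
    using f
  proof (induction I rule: infinite_finite_induct)
    case (insert i I)
    have "(\<Sum>i\<in>I. a i *\<^sub>C f i) \<in> cspan B"
      using insert by (intro complex_vector.span_sum complex_vector.span_scale) auto
    with insert show ?case
      by (simp add: linear_operator_onD[OF M] complex_vector.span_scale)
  qed (simp_all add: 0)
qed

lemma adjoint_on_unique:
  assumes w: "w \<in> cspan B" "\<And>u. u \<in> cspan B \<Longrightarrow> cinner (M u) v = cinner u w"
  shows "adjoint_on (cspan B) M v = w"
  unfolding adjoint_on_def
proof (rule the_equality)
  show "w \<in> cspan B \<and> (\<forall>u\<in>cspan B. cinner (M u) v = cinner u w)" using w by blast
next
  fix w' assume w': "w' \<in> cspan B \<and> (\<forall>u\<in>cspan B. cinner (M u) v = cinner u w')"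
  then have "w' - w \<in> cspan B" using w by (intro complex_vector.span_diff) auto
  then have "cinner (w' - w) (w' - w) = 0"
    using w w' by (metis cinner_diff_right right_minus_eq)
  then show "w' = w" by simp
qed

lemma adjoint_on:
  assumes B: "finite B" and M: "linear_operator_on (cspan B) M"
  shows adjoint_on_in_span: "adjoint_on (cspan B) M v \<in> cspan B"
    and cinner_adjoint_on: "u \<in> cspan B \<Longrightarrow> cinner (M u) v = cinner u (adjoint_on (cspan B) M v)"
proof -
  have "linear_functional_on (cspan B) (\<lambda>u. cinner (M u) v)"
    by (auto simp: linear_functional_on_def linear_operator_onD[OF M] cinner_add_left cinner_scaleC_left)
  from riesz_representation[OF B this] obtain w where
    w: "w \<in> cspan B" "\<And>u. u \<in> cspan B \<Longrightarrow> cinner (M u) v = cinner u w" by blast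
  have "adjoint_on (cspan B) M v = w" by (rule adjoint_on_unique) (use w in auto)
  with w show "adjoint_on (cspan B) M v \<in> cspan B"
    "u \<in> cspan B \<Longrightarrow> cinner (M u) v = cinner u (adjoint_on (cspan B) M v)" by auto
qed

lemma linear_adjoint_on:
  assumes "finite B" and "linear_operator_on (cspan B) M"
  shows "linear_operator_on (cspan B) (adjoint_on (cspan B) M)"
  unfolding linear_operator_on_def
proof (intro conjI ballI allI)
  note a = adjoint_on[OF assms]
  show "adjoint_on (cspan B) M u \<in> cspan B" for u by (rule a)
  show "adjoint_on (cspan B) M (u + v) = adjoint_on (cspan B) M u + adjoint_on (cspan B) M v" for u v
    by (rule adjoint_on_unique) (simp_all add: a complex_vector.span_add cinner_add_right)
  show "adjoint_on (cspan B) M (c *\<^sub>C u) = c *\<^sub>C adjoint_on (cspan B) M u" for c u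
    by (rule adjoint_on_unique) (simp_all add: a complex_vector.span_scale cinner_scaleC_right)
qed

lemma adjoint_on_adjoint_on:
  assumes "finite B" and M: "linear_operator_on (cspan B) M" and v: "v \<in> cspan B"
  shows "adjoint_on (cspan B) (adjoint_on (cspan B) M) v = M v"
proof (rule adjoint_on_unique)
  show "M v \<in> cspan B" using linear_operator_onD(1)[OF M v] .
  show "cinner (adjoint_on (cspan B) M u) v = cinner u (M v)" if "u \<in> cspan B" for u
    using cinner_adjoint_on[OF assms(1,2) v, of u] by (metis cinner_commute)
qed

text \<open>The operator diagonal in the basis \<open>K\<close> with entries \<open>e k\<close> is
  formed first; the multiplier is its adjoint, because the eigenvector condition concerns the
  adjoint of a multiplier.\<close>

lemma multiplier_with_eigenvalues:
  assumes K: "rkhs K"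
  shows "\<exists>M. multiplier K M \<and> (\<forall>k\<in>K. adjoint_on (cspan K) M k = e k *\<^sub>C k)"
proof -
  have fin: "finite K" and ind: "cindependent K" using K by (auto simp: rkhs_def)
  define A where "A v = (\<Sum>k\<in>K. (crepresentation K v k * e k) *\<^sub>C k)" for v
  have A: "linear_operator_on (cspan K) A"
    unfolding linear_operator_on_def
  proof (intro conjI ballI allI)
    show "A u \<in> cspan K" for u
      unfolding A_def by (intro complex_vector.span_sum complex_vector.span_scale complex_vector.span_base)
    show "A (u + v) = A u + A v" if "u \<in> cspan K" "v \<in> cspan K" for u v
      by (simp add: A_def complex_vector.representation_add[OF ind that(2,1)]
          sum.distrib distrib_right complex_vector.scale_left_distrib)
    show "A (a *\<^sub>C u) = a *\<^sub>C A u" if "u \<in> cspan K" for a u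
      by (simp add: A_def complex_vector.representation_scale[OF ind that]
          complex_vector.scale_sum_right mult.assoc)
  qed
  have Ak: "A k = e k *\<^sub>C k" if "k \<in> K" for k
  proof -
    have "A k = (\<Sum>l\<in>K. if l = k then e k *\<^sub>C k else 0)"
      unfolding A_def
      by (rule sum.cong) (use that in \<open>auto simp: complex_vector.representation_basis[OF ind that]\<close>)
    then show ?thesis using that fin by simp
  qed
  have "adjoint_on (cspan K) (adjoint_on (cspan K) A) k = e k *\<^sub>C k" if "k \<in> K" for k
    using adjoint_on_adjoint_on[OF fin A complex_vector.span_base[OF that]] Ak[OF that] by simp
  then show ?thesis
    using linear_adjoint_on[OF fin A] unfolding multiplier_def
    by (intro exI[of _ "adjoint_on (cspan K) A"]) blast
qed

section \<open>Boundedness and duality for operator matrices\<close>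

lemma cspan_finite_coords:
  assumes "finite K" "v \<in> cspan K"
  shows "\<exists>a. v = (\<Sum>k\<in>K. a k *\<^sub>C k)"
  using assms complex_vector.span_finite by auto

text \<open>Coordinates with respect to \<open>K\<close> are bounded functionals, being represented
  by vectors \<open>w k\<close>. Boundedness of the operators makes the \<open>Sup\<close> in
  \<open>matrix_opnorm\<close> meaningful.\<close>

lemma linear_operator_on_bounded:
  assumes K: "rkhs K" and M: "linear_operator_on (cspan K) M"
  shows "\<exists>C\<ge>0. \<forall>v\<in>cspan K. norm (M v) \<le> C * norm v"
proof -
  have fin: "finite K" and ind: "cindependent K" using K by (auto simp: rkhs_def)
  have "\<exists>w. \<forall>u\<in>cspan K. crepresentation K u k = cinner u w" for k
  proof -
    have "linear_functional_on (cspan K) (\<lambda>u. crepresentation K u k)"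
      by (auto simp: linear_functional_on_def complex_vector.representation_add[OF ind]
          complex_vector.representation_scale[OF ind])
    from riesz_representation[OF fin this] show ?thesis by blast
  qed
  then obtain w where w: "\<And>k u. u \<in> cspan K \<Longrightarrow> crepresentation K u k = cinner u (w k)" by metis
  let ?C = "\<Sum>k\<in>K. norm (w k) * norm (M k)"
  have "norm (M v) \<le> ?C * norm v" if v: "v \<in> cspan K" for v
  proof -
    have "v = (\<Sum>k\<in>K. crepresentation K v k *\<^sub>C k)"
      using complex_vector.sum_representation_eq[OF ind v fin subset_refl] by simp
    then have "M v = (\<Sum>k\<in>K. cinner v (w k) *\<^sub>C M k)"
      using linear_operator_on_sum[OF M, of K "\<lambda>k. k" "crepresentation K v"] w[OF v]
      by (simp add: complex_vector.span_base)
    also have "norm \<dots> \<le> (\<Sum>k\<in>K. norm (cinner v (w k) *\<^sub>C M k))" by (rule norm_sum)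
    also have "\<dots> \<le> (\<Sum>k\<in>K. norm (w k) * norm (M k) * norm v)"
    proof (rule sum_mono)
      fix k
      have "cmod (cinner v (w k)) * norm (M k) \<le> norm v * norm (w k) * norm (M k)"
        by (intro mult_right_mono cinner_le_norm) simp
      then show "norm (cinner v (w k) *\<^sub>C M k) \<le> norm (w k) * norm (M k) * norm v"
        by (simp add: norm_scaleC mult_ac)
    qed
    finally show ?thesis by (simp add: sum_distrib_right)
  qed
  moreover have "0 \<le> ?C" by (intro sum_nonneg mult_nonneg_nonneg) auto
  ultimately show ?thesis by blast
qed

lemma matrix_opnorm_set_bounded:
  fixes s t :: nat
  assumes K: "rkhs K" and F: "\<And>i j. i < s \<Longrightarrow> j < t \<Longrightarrow> linear_operator_on (cspan K) (F i j)"
  shows "\<exists>C. \<forall>u. (\<forall>j<t. u j \<in> cspan K) \<longrightarrow> L2_set (\<lambda>j. norm (u j)) {..<t} \<le> 1 \<longrightarrow>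
    L2_set (\<lambda>i. norm (\<Sum>j<t. F i j (u j))) {..<s} \<le> C"
proof -
  have "\<exists>C\<ge>0. \<forall>v\<in>cspan K. norm (F i j v) \<le> C * norm v" if "i < s" "j < t" for i j
    using linear_operator_on_bounded[OF K F[OF that]] .
  then obtain C where C: "\<And>i j v. i < s \<Longrightarrow> j < t \<Longrightarrow> v \<in> cspan K \<Longrightarrow> norm (F i j v) \<le> C i j * norm v"
    and C0: "\<And>i j. i < s \<Longrightarrow> j < t \<Longrightarrow> 0 \<le> C i j" by metis
  have "L2_set (\<lambda>i. norm (\<Sum>j<t. F i j (u j))) {..<s} \<le> (\<Sum>i<s. \<Sum>j<t. C i j)"
    if u: "\<forall>j<t. u j \<in> cspan K" "L2_set (\<lambda>j. norm (u j)) {..<t} \<le> 1" for u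
  proof -
    have u1: "norm (u j) \<le> 1" if "j < t" for j
      using member_le_L2_set[of "{..<t}" j "\<lambda>j. norm (u j)"] that u(2) by simp
    have "L2_set (\<lambda>i. norm (\<Sum>j<t. F i j (u j))) {..<s} \<le> (\<Sum>i<s. norm (\<Sum>j<t. F i j (u j)))"
      by (rule L2_set_le_sum) simp
    also have "\<dots> \<le> (\<Sum>i<s. \<Sum>j<t. C i j)"
    proof (rule sum_mono)
      fix i assume i: "i \<in> {..<s}"
      have "norm (F i j (u j)) \<le> C i j" if "j < t" for j
      proof -
        have "norm (F i j (u j)) \<le> C i j * norm (u j)" using C i u that by simp
        also have "\<dots> \<le> C i j" using C0[of i j] u1[OF that] i that by (simp add: mult_left_le)
        finally show ?thesis .
      qed
      then show "norm (\<Sum>j<t. F i j (u j)) \<le> (\<Sum>j<t. C i j)"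
        by (intro order_trans[OF norm_sum] sum_mono) simp
    qed
    finally show ?thesis .
  qed
  then show ?thesis by blast
qed

text \<open>Homogeneity turns the supremum over the unit ball into a bound for all tuples, which is
  the form that duality needs.\<close>

lemma matrix_opnorm_le_iff:
  assumes K: "rkhs K" and F: "\<And>i j. i < s \<Longrightarrow> j < t \<Longrightarrow> linear_operator_on (cspan K) (F i j)"
    and c: "0 \<le> c"
  shows "matrix_opnorm s t (cspan K) F \<le> c \<longleftrightarrow> (\<forall>u. (\<forall>j<t. u j \<in> cspan K) \<longrightarrow>
    L2_set (\<lambda>i. norm (\<Sum>j<t. F i j (u j))) {..<s} \<le> c * L2_set (\<lambda>j. norm (u j)) {..<t})"
    (is "_ \<longleftrightarrow> ?R")
proof -
  let ?X = "{L2_set (\<lambda>i. norm (\<Sum>j<t. F i j (u j))) {..<s} | u.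
            (\<forall>j<t. u j \<in> cspan K) \<and> L2_set (\<lambda>j. norm (u j)) {..<t} \<le> 1}"
  have "\<exists>C. \<forall>u. (\<forall>j<t. u j \<in> cspan K) \<longrightarrow> L2_set (\<lambda>j. norm (u j)) {..<t} \<le> 1 \<longrightarrow>
    L2_set (\<lambda>i. norm (\<Sum>j<t. F i j (u j))) {..<s} \<le> C"
    by (rule matrix_opnorm_set_bounded[OF K]) (rule F)
  then obtain C where C: "\<And>u. (\<forall>j<t. u j \<in> cspan K) \<Longrightarrow> L2_set (\<lambda>j. norm (u j)) {..<t} \<le> 1 \<Longrightarrow>
    L2_set (\<lambda>i. norm (\<Sum>j<t. F i j (u j))) {..<s} \<le> C"
    by blast
  have bdd: "bdd_above ?X"
    by (rule bdd_aboveI[of _ C]) (use C in blast)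
  have ne: "?X \<noteq> {}"
  proof -
    have "L2_set (\<lambda>i. norm (\<Sum>j<t. F i j ((\<lambda>_. 0) j))) {..<s} \<in> ?X"
      by (intro CollectI exI[of _ "\<lambda>_. 0"]) (simp add: complex_vector.span_zero L2_set_def)
    then show ?thesis by blast
  qed
  have 0: "F i j 0 = 0" if "i < s" "j < t" for i j
    using linear_operator_onD(3)[OF F[OF that] complex_vector.span_zero, of 0] by simp
  show ?thesis
  proof
    assume le: "matrix_opnorm s t (cspan K) F \<le> c"
    show ?R
    proof (intro allI impI)
      fix u assume u: "\<forall>j<t. u j \<in> cspan K"
      define N where "N = L2_set (\<lambda>j. norm (u j)) {..<t}"
      have N0: "0 \<le> N" by (simp add: N_def)
      show "L2_set (\<lambda>i. norm (\<Sum>j<t. F i j (u j))) {..<s} \<le> c * L2_set (\<lambda>j. norm (u j)) {..<t}"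
      proof (cases "N = 0")
        case True
        then have "u j = 0" if "j < t" for j
          using member_le_L2_set[of "{..<t}" j "\<lambda>j. norm (u j)"] that by (simp add: N_def)
        then have "L2_set (\<lambda>i. norm (\<Sum>j<t. F i j (u j))) {..<s} = L2_set (\<lambda>i. 0) {..<s}"
          using 0 by (intro L2_set_cong) auto
        also have "\<dots> = 0" by (simp add: L2_set_def)
        finally show ?thesis using True by (simp add: N_def)
      next
        case False
        define a where "a = complex_of_real (1 / N)"
        have a: "cmod a = 1 / N" using N0 by (simp add: a_def norm_divide)
        let ?u = "\<lambda>j. a *\<^sub>C u j"
        have "L2_set (\<lambda>j. norm (?u j)) {..<t} = 1 / N * N"
          unfolding norm_scaleC a N_def
          by (intro L2_set_right_distrib[symmetric]) simp
        then have "L2_set (\<lambda>j. norm (?u j)) {..<t} = 1" using False by simp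
        moreover have "\<forall>j<t. ?u j \<in> cspan K" using u by (simp add: complex_vector.span_scale)
        ultimately have "L2_set (\<lambda>i. norm (\<Sum>j<t. F i j (?u j))) {..<s} \<in> ?X"
          by (intro CollectI exI[of _ ?u]) simp
        then have "L2_set (\<lambda>i. norm (\<Sum>j<t. F i j (?u j))) {..<s} \<le> c"
          using cSup_upper[OF _ bdd] le unfolding matrix_opnorm_def by fastforce
        also have "L2_set (\<lambda>i. norm (\<Sum>j<t. F i j (?u j))) {..<s} =
            L2_set (\<lambda>i. 1 / N * norm (\<Sum>j<t. F i j (u j))) {..<s}"
        proof (intro L2_set_cong refl)
          fix i assume "i \<in> {..<s}"
          then have "(\<Sum>j<t. F i j (?u j)) = a *\<^sub>C (\<Sum>j<t. F i j (u j))"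
            using u by (simp add: complex_vector.scale_sum_right linear_operator_onD(3)[OF F])
          then show "norm (\<Sum>j<t. F i j (?u j)) = 1 / N * norm (\<Sum>j<t. F i j (u j))"
            by (simp add: norm_scaleC a)
        qed
        also have "\<dots> = 1 / N * L2_set (\<lambda>i. norm (\<Sum>j<t. F i j (u j))) {..<s}"
          using N0 by (intro L2_set_right_distrib[symmetric]) simp
        finally show ?thesis using False N0 by (simp add: N_def[symmetric] field_simps)
      qed
    qed
  next
    assume R: ?R
    show "matrix_opnorm s t (cspan K) F \<le> c"
      unfolding matrix_opnorm_def
    proof (rule cSup_least[OF ne])
      fix x assume "x \<in> ?X"
      then obtain u where u: "\<forall>j<t. u j \<in> cspan K" "L2_set (\<lambda>j. norm (u j)) {..<t} \<le> 1"
        "x = L2_set (\<lambda>i. norm (\<Sum>j<t. F i j (u j))) {..<s}" by blast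
      with R have "x \<le> c * L2_set (\<lambda>j. norm (u j)) {..<t}" by blast
      also have "\<dots> \<le> c" using c u(2) by (rule mult_left_le[rotated])
      finally show "x \<le> c" .
    qed
  qed
qed

lemma matrix_opnorm_nonneg:
  assumes K: "rkhs K" and F: "\<And>i j. i < s \<Longrightarrow> j < t \<Longrightarrow> linear_operator_on (cspan K) (F i j)"
  shows "0 \<le> matrix_opnorm s t (cspan K) F"
proof -
  have "\<exists>C. \<forall>u. (\<forall>j<t. u j \<in> cspan K) \<longrightarrow> L2_set (\<lambda>j. norm (u j)) {..<t} \<le> 1 \<longrightarrow>
    L2_set (\<lambda>i. norm (\<Sum>j<t. F i j (u j))) {..<s} \<le> C"
    by (rule matrix_opnorm_set_bounded[OF K]) (rule F)
  then obtain C where C: "\<And>u. (\<forall>j<t. u j \<in> cspan K) \<Longrightarrow> L2_set (\<lambda>j. norm (u j)) {..<t} \<le> 1 \<Longrightarrow>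
    L2_set (\<lambda>i. norm (\<Sum>j<t. F i j (u j))) {..<s} \<le> C"
    by blast
  show ?thesis
    unfolding matrix_opnorm_def
  proof (rule cSup_upper2)
  show "L2_set (\<lambda>i. norm (\<Sum>j<t. F i j ((\<lambda>_. 0) j))) {..<s} \<in>
    {L2_set (\<lambda>i. norm (\<Sum>j<t. F i j (u j))) {..<s} | u.
            (\<forall>j<t. u j \<in> cspan K) \<and> L2_set (\<lambda>j. norm (u j)) {..<t} \<le> 1}"
    by (intro CollectI exI[of _ "\<lambda>_. 0"]) (simp add: complex_vector.span_zero L2_set_def)
  show "bdd_above {L2_set (\<lambda>i. norm (\<Sum>j<t. F i j (u j))) {..<s} | u.
            (\<forall>j<t. u j \<in> cspan K) \<and> L2_set (\<lambda>j. norm (u j)) {..<t} \<le> 1}"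
    by (rule bdd_aboveI[of _ C]) (use C in blast)
  qed simp
qed

lemma cmod_sum_cinner_le_L2_set:
  "cmod (\<Sum>i\<in>I. cinner (f i) (g i)) \<le> L2_set (\<lambda>i. norm (f i)) I * L2_set (\<lambda>i. norm (g i)) I"
proof -
  have "cmod (\<Sum>i\<in>I. cinner (f i) (g i)) \<le> (\<Sum>i\<in>I. norm (f i) * norm (g i))"
    by (intro order_trans[OF norm_sum] sum_mono cinner_le_norm)
  also have "\<dots> \<le> L2_set (\<lambda>i. norm (f i)) I * L2_set (\<lambda>i. norm (g i)) I"
    using L2_set_mult_ineq[of "\<lambda>i. norm (f i)" "\<lambda>i. norm (g i)" I] by simp
  finally show ?thesis .
qed

text \<open>With \<open>w = F u\<close>, the estimate
  \<open>|w|^2 = <u, A w> \<le> c |u| |w|\<close> can be divided by \<open>|w|\<close>. The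
  operators enter only through adjunction on \<open>V\<close>, so the lemma also serves with
  \<open>F\<close> and \<open>A\<close> exchanged.\<close>

lemma L2_bound_adjoint:
  fixes F :: "nat \<Rightarrow> nat \<Rightarrow> 'a \<Rightarrow> 'a::complex_inner"
  assumes in_span: "\<And>i j u. i < s \<Longrightarrow> j < t \<Longrightarrow> u \<in> V \<Longrightarrow> F i j u \<in> V" and V: "csubspace V"
    and adj: "\<And>i j u v. i < s \<Longrightarrow> j < t \<Longrightarrow> u \<in> V \<Longrightarrow> v \<in> V \<Longrightarrow> cinner (F i j u) v = cinner u (A i j v)"
    and A: "\<And>v. (\<forall>i<s. v i \<in> V) \<Longrightarrow>
      L2_set (\<lambda>j. norm (\<Sum>i<s. A i j (v i))) {..<t} \<le> c * L2_set (\<lambda>i. norm (v i)) {..<s}"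
    and u: "\<forall>j<t. u j \<in> V" and "0 \<le> c"
  shows "L2_set (\<lambda>i. norm (\<Sum>j<t. F i j (u j))) {..<s} \<le> c * L2_set (\<lambda>j. norm (u j)) {..<t}"
proof -
  define w where "w i = (\<Sum>j<t. F i j (u j))" for i
  define N where "N = L2_set (\<lambda>i. norm (w i)) {..<s}"
  have w: "\<forall>i<s. w i \<in> V"
    unfolding w_def using in_span u V by (auto intro!: complex_vector.subspace_sum)
  have "(\<Sum>i<s. cinner (w i) (w i)) = of_real (N\<^sup>2)"
    by (simp add: cinner_self N_def L2_set_def sum_nonneg)
  moreover have "(\<Sum>i<s. cinner (w i) (w i)) = (\<Sum>i<s. \<Sum>j<t. cinner (u j) (A i j (w i)))"
  proof (rule sum.cong)
    fix i assume i: "i \<in> {..<s}"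
    have "cinner (w i) (w i) = (\<Sum>j<t. cinner (F i j (u j)) (w i))"
      by (subst w_def) (simp add: cinner_sum_left)
    then show "cinner (w i) (w i) = (\<Sum>j<t. cinner (u j) (A i j (w i)))"
      using i u w adj by simp
  qed simp
  moreover have "\<dots> = (\<Sum>j<t. cinner (u j) (\<Sum>i<s. A i j (w i)))"
    by (subst sum.swap) (simp add: cinner_sum_right)
  ultimately have "N\<^sup>2 = cmod (\<Sum>j<t. cinner (u j) (\<Sum>i<s. A i j (w i)))"
    by (metis norm_of_real abs_power2)
  also have "\<dots> \<le> L2_set (\<lambda>j. norm (u j)) {..<t} * L2_set (\<lambda>j. norm (\<Sum>i<s. A i j (w i))) {..<t}"
    by (rule cmod_sum_cinner_le_L2_set)
  also have "\<dots> \<le> L2_set (\<lambda>j. norm (u j)) {..<t} * (c * N)"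
    unfolding N_def by (intro mult_left_mono A w) simp
  finally have *: "N * N \<le> (c * L2_set (\<lambda>j. norm (u j)) {..<t}) * N"
    by (simp add: power2_eq_square mult_ac)
  have N0: "0 \<le> N" by (simp add: N_def)
  have "N \<le> c * L2_set (\<lambda>j. norm (u j)) {..<t}"
  proof (cases "N = 0")
    case True
    with \<open>0 \<le> c\<close> show ?thesis by simp
  next
    case False
    with N0 * show ?thesis by simp
  qed
  then show ?thesis by (simp add: N_def w_def)
qed

section \<open>Pick matrices\<close>

text \<open>The coordinates of a tuple \<open>v\<close> in \<open>H^s\<close> with respect to the
  kernels are indexed by pairs of a kernel and a row number. In these coordinates this is the matrix
  of the form \<open>c^2 |v|^2 - |A v|^2\<close>, where \<open>A\<close> is the matrix of adjoints
  with eigenvalues \<open>e\<close>.\<close>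

definition pick_matrix ::
  "nat \<Rightarrow> real \<Rightarrow> (nat \<Rightarrow> nat \<Rightarrow> 'a \<Rightarrow> complex) \<Rightarrow> 'a::complex_inner \<times> nat \<Rightarrow> 'a \<times> nat \<Rightarrow> complex" where
  "pick_matrix t c e p q = cinner (fst p) (fst q) *
     ((if snd p = snd q then of_real (c\<^sup>2) else 0) -
      (\<Sum>j<t. e (snd p) j (fst p) * cnj (e (snd q) j (fst q))))"

lemma cinner_sum_scaleC:
  "cinner (\<Sum>p\<in>I. a p *\<^sub>C x p) (\<Sum>q\<in>I. b q *\<^sub>C y q) =
    (\<Sum>p\<in>I. \<Sum>q\<in>I. a p * cnj (b q) * cinner (x p) (y q))"
  by (simp add: cinner_sum_left cinner_sum_right cinner_scaleC_left cinner_scaleC_right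
      sum_distrib_left mult_ac) (rule sum.swap)

lemma pick_matrix_commute: "pick_matrix t c e q p = cnj (pick_matrix t c e p q)"
  unfolding pick_matrix_def by (subst cinner_commute) (simp add: mult_ac)

text \<open>Here \<open>v a\<close> is the tuple with coordinates \<open>a\<close>, and
  \<open>w a\<close> is its image under the matrix of adjoints; both squared norms are expanded over
  pairs of indices.\<close>

lemma qform_pick_matrix:
  fixes e :: "nat \<Rightarrow> nat \<Rightarrow> 'a::complex_inner \<Rightarrow> complex"
  assumes I: "I = K \<times> {..<s}"
  defines "v \<equiv> \<lambda>a i. \<Sum>p\<in>I. (if snd p = i then a p else 0) *\<^sub>C fst p"
    and "w \<equiv> \<lambda>a j. \<Sum>p\<in>I. (a p * e (snd p) j (fst p)) *\<^sub>C fst p"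
  shows "Re (qform I (pick_matrix t c e) a a) =
    c\<^sup>2 * (\<Sum>i<s. (norm (v a i))\<^sup>2) - (\<Sum>j<t. (norm (w a j))\<^sup>2)"
proof -
  let ?g = "\<lambda>p q. cinner (fst p) (fst q)"
  have "(\<Sum>i<s. cinner (v a i) (v a i)) =
      (\<Sum>i<s. \<Sum>p\<in>I. \<Sum>q\<in>I. (if snd p = i then a p else 0) * cnj (if snd q = i then a q else 0) * ?g p q)"
    unfolding v_def by (simp only: cinner_sum_scaleC)
  also have "\<dots> = (\<Sum>p\<in>I. \<Sum>i<s. \<Sum>q\<in>I. (if snd p = i then a p else 0) * cnj (if snd q = i then a q else 0) * ?g p q)"
    by (rule sum.swap)
  also have "\<dots> = (\<Sum>p\<in>I. \<Sum>q\<in>I. \<Sum>i<s. (if snd p = i then a p else 0) * cnj (if snd q = i then a q else 0) * ?g p q)"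
    by (intro sum.cong refl sum.swap)
  also have "\<dots> = (\<Sum>p\<in>I. \<Sum>q\<in>I. if snd p = snd q then a p * cnj (a q) * ?g p q else 0)"
  proof (intro sum.cong refl)
    fix p q assume p: "p \<in> I"
    have "(\<Sum>i<s. (if snd p = i then a p else 0) * cnj (if snd q = i then a q else 0) * ?g p q) =
        (\<Sum>i<s. if i = snd p then (if snd p = snd q then a p * cnj (a q) * ?g p q else 0) else 0)"
      by (rule sum.cong) auto
    then show "(\<Sum>i<s. (if snd p = i then a p else 0) * cnj (if snd q = i then a q else 0) * ?g p q) =
        (if snd p = snd q then a p * cnj (a q) * ?g p q else 0)"
      using p by (simp add: I mem_Times_iff)
  qed
  finally have V: "(\<Sum>i<s. cinner (v a i) (v a i)) = \<dots>" .
  have "(\<Sum>j<t. cinner (w a j) (w a j)) =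
      (\<Sum>j<t. \<Sum>p\<in>I. \<Sum>q\<in>I. (a p * e (snd p) j (fst p)) * cnj (a q * e (snd q) j (fst q)) * ?g p q)"
    unfolding w_def by (simp only: cinner_sum_scaleC)
  also have "\<dots> = (\<Sum>p\<in>I. \<Sum>j<t. \<Sum>q\<in>I. (a p * e (snd p) j (fst p)) * cnj (a q * e (snd q) j (fst q)) * ?g p q)"
    by (rule sum.swap)
  also have "\<dots> = (\<Sum>p\<in>I. \<Sum>q\<in>I. \<Sum>j<t. (a p * e (snd p) j (fst p)) * cnj (a q * e (snd q) j (fst q)) * ?g p q)"
    by (intro sum.cong refl sum.swap)
  finally have W: "(\<Sum>j<t. cinner (w a j) (w a j)) = \<dots>" .
  have "qform I (pick_matrix t c e) a a =
    of_real (c\<^sup>2) * (\<Sum>i<s. cinner (v a i) (v a i)) - (\<Sum>j<t. cinner (w a j) (w a j))"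
    unfolding V W qform_def sum_distrib_left sum_subtractf[symmetric]
  proof (intro sum.cong refl, rule sym)
    fix p q
    have "(\<Sum>j<t. (a p * e (snd p) j (fst p)) * cnj (a q * e (snd q) j (fst q)) * ?g p q) =
      a p * cnj (a q) * ?g p q * (\<Sum>j<t. e (snd p) j (fst p) * cnj (e (snd q) j (fst q)))"
      unfolding sum_distrib_left by (rule sum.cong) simp_all
    then show "of_real (c\<^sup>2) * (if snd p = snd q then a p * cnj (a q) * ?g p q else 0) -
      (\<Sum>j<t. (a p * e (snd p) j (fst p)) * cnj (a q * e (snd q) j (fst q)) * ?g p q) =
      a p * cnj (a q) * pick_matrix t c e p q"
      by (simp add: pick_matrix_def right_diff_distrib)
  qed
  also have "\<dots> = of_real (c\<^sup>2 * (\<Sum>i<s. (norm (v a i))\<^sup>2) - (\<Sum>j<t. (norm (w a j))\<^sup>2))"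
    by (simp add: cinner_self)
  finally show ?thesis by (simp only: Re_complex_of_real)
qed

text \<open>An operator matrix and its adjoint satisfy the same norm bounds, and on combinations of
  kernels the adjoint acts through the eigenvalues alone; \<open>qform_pick_matrix\<close> then
  rewrites the bound as positivity.\<close>

lemma matrix_opnorm_le_iff_psd_on:
  assumes K: "rkhs K" and F: "\<And>i j. i < s \<Longrightarrow> j < t \<Longrightarrow> multiplier K (F i j)"
    and e: "\<And>i j k. i < s \<Longrightarrow> j < t \<Longrightarrow> k \<in> K \<Longrightarrow> adjoint_on (cspan K) (F i j) k = e i j k *\<^sub>C k"
    and c: "0 \<le> c"
  shows "matrix_opnorm s t (cspan K) F \<le> c \<longleftrightarrow> psd_on (K \<times> {..<s}) (pick_matrix t c e)"
proof -
  have fin: "finite K" using K by (simp add: rkhs_def)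
  let ?V = "cspan K"
  define A where "A i j = adjoint_on ?V (F i j)" for i j
  have Flin: "linear_operator_on ?V (F i j)" if "i < s" "j < t" for i j
    using F[OF that] by (simp add: multiplier_def)
  have Alin: "linear_operator_on ?V (A i j)" if "i < s" "j < t" for i j
    unfolding A_def by (rule linear_adjoint_on[OF fin Flin[OF that]])
  have FA: "cinner (F i j u) v = cinner u (A i j v)" if "i < s" "j < t" "u \<in> ?V" for i j u v
    unfolding A_def by (rule cinner_adjoint_on[OF fin Flin[OF that(1,2)] that(3)])
  have AF: "cinner (A j i u) v = cinner u (F j i v)" if "i < t" "j < s" "u \<in> ?V" "v \<in> ?V" for i j u v
    using FA[OF that(2,1,4), of u] by (metis cinner_commute)
  have FV: "F i j u \<in> ?V" and AV: "A i j u \<in> ?V" if "i < s" "j < t" "u \<in> ?V" for i j u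
    using linear_operator_onD(1)[OF Flin[OF that(1,2)] that(3)]
      linear_operator_onD(1)[OF Alin[OF that(1,2)] that(3)] by auto
  have N: "matrix_opnorm s t ?V F \<le> c \<longleftrightarrow> (\<forall>u. (\<forall>j<t. u j \<in> ?V) \<longrightarrow>
    L2_set (\<lambda>i. norm (\<Sum>j<t. F i j (u j))) {..<s} \<le> c * L2_set (\<lambda>j. norm (u j)) {..<t})"
    by (rule matrix_opnorm_le_iff[OF K _ c]) (rule Flin)
  also have "\<dots> \<longleftrightarrow> (\<forall>v. (\<forall>i<s. v i \<in> ?V) \<longrightarrow>
    L2_set (\<lambda>j. norm (\<Sum>i<s. A i j (v i))) {..<t} \<le> c * L2_set (\<lambda>i. norm (v i)) {..<s})" (is "?F = ?A")
  proof
    assume F': ?F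
    show ?A
    proof (intro allI impI)
      fix v assume "\<forall>i<s. v i \<in> ?V"
      \<comment> \<open>Duality with the adjoints in the role of the operators and the indices
        transposed.\<close>
      then show "L2_set (\<lambda>j. norm (\<Sum>i<s. A i j (v i))) {..<t} \<le> c * L2_set (\<lambda>i. norm (v i)) {..<s}"
        by (intro L2_bound_adjoint[where V = ?V and F = "\<lambda>j i. A i j" and A = "\<lambda>j i. F i j"])
          (use AV AF F' c in auto)
    qed
  next
    assume A': ?A
    show ?F
    proof (intro allI impI)
      fix u assume "\<forall>j<t. u j \<in> ?V"
      then show "L2_set (\<lambda>i. norm (\<Sum>j<t. F i j (u j))) {..<s} \<le> c * L2_set (\<lambda>j. norm (u j)) {..<t}"
        by (intro L2_bound_adjoint[where V = ?V and F = F and A = A])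
          (use FV FA A' c in auto)
    qed
  qed
  also have "\<dots> \<longleftrightarrow> psd_on (K \<times> {..<s}) (pick_matrix t c e)"
  proof -
    define I where "I = K \<times> {..<s}"
    define v where "v a i = (\<Sum>p\<in>I. (if snd p = i then a p else 0) *\<^sub>C fst p)" for a :: "'a \<times> nat \<Rightarrow> complex" and i
    define w where "w a j = (\<Sum>p\<in>I. (a p * e (snd p) j (fst p)) *\<^sub>C fst p)" for a :: "'a \<times> nat \<Rightarrow> complex" and j
    have q: "Re (qform I (pick_matrix t c e) a a) =
      c\<^sup>2 * (\<Sum>i<s. (norm (v a i))\<^sup>2) - (\<Sum>j<t. (norm (w a j))\<^sup>2)" for a
      unfolding v_def w_def by (rule qform_pick_matrix[OF I_def])
    have vV: "v a i \<in> ?V" for a i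
      unfolding v_def I_def
      by (intro complex_vector.span_sum complex_vector.span_scale complex_vector.span_base) auto
    have Av: "(\<Sum>i<s. A i j (v a i)) = w a j" if j: "j < t" for a j
    proof -
      have "(\<Sum>i<s. A i j (v a i)) = (\<Sum>i<s. \<Sum>p\<in>I. (if snd p = i then a p else 0) *\<^sub>C A i j (fst p))"
        unfolding v_def
        by (intro sum.cong refl linear_operator_on_sum[OF Alin] j) (auto simp: I_def intro: complex_vector.span_base)
      also have "\<dots> = (\<Sum>p\<in>I. \<Sum>i<s. (if snd p = i then a p else 0) *\<^sub>C A i j (fst p))"
        by (rule sum.swap)
      also have "\<dots> = w a j"
        unfolding w_def
      proof (rule sum.cong)
        fix p assume p: "p \<in> I"
        have "(\<Sum>i<s. (if snd p = i then a p else 0) *\<^sub>C A i j (fst p)) =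
          (\<Sum>i<s. if i = snd p then a p *\<^sub>C A (snd p) j (fst p) else 0)"
          by (rule sum.cong) auto
        also have "\<dots> = (a p * e (snd p) j (fst p)) *\<^sub>C fst p"
          using p j by (auto simp: I_def A_def e)
        finally show "(\<Sum>i<s. (if snd p = i then a p else 0) *\<^sub>C A i j (fst p)) =
          (a p * e (snd p) j (fst p)) *\<^sub>C fst p" .
      qed simp
      finally show ?thesis .
    qed
    have iff: "L2_set (\<lambda>j. norm (\<Sum>i<s. A i j (v a i))) {..<t} \<le> c * L2_set (\<lambda>i. norm (v a i)) {..<s} \<longleftrightarrow>
      0 \<le> Re (qform I (pick_matrix t c e) a a)" for a
    proof -
      have "L2_set (\<lambda>j. norm (\<Sum>i<s. A i j (v a i))) {..<t} = L2_set (\<lambda>j. norm (w a j)) {..<t}"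
        by (rule L2_set_cong) (simp_all add: Av)
      moreover have "c * L2_set (\<lambda>i. norm (v a i)) {..<s} = sqrt (c\<^sup>2 * (\<Sum>i<s. (norm (v a i))\<^sup>2))"
        using c by (simp add: L2_set_def real_sqrt_mult)
      ultimately show ?thesis unfolding q by (simp add: L2_set_def)
    qed
    \<comment> \<open>The kernels span \<open>?V\<close>, so the tuples \<open>v a\<close> exhaust
      \<open>?V^s\<close> and the equivalence \<open>iff\<close> accounts for the whole norm
      bound.\<close>
    have surj: "\<exists>a. \<forall>i<s. u i = v a i" if u: "\<forall>i<s. u i \<in> ?V" for u
    proof -
      have "\<forall>i\<in>{..<s}. \<exists>b. u i = (\<Sum>k\<in>K. b k *\<^sub>C k)" using cspan_finite_coords[OF fin] u by auto
      then obtain b where b: "\<And>i. i < s \<Longrightarrow> u i = (\<Sum>k\<in>K. b i k *\<^sub>C k)" by (metis lessThan_iff)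
      have "u i = v (\<lambda>p. b (snd p) (fst p)) i" if i: "i < s" for i
      proof -
        have "v (\<lambda>p. b (snd p) (fst p)) i = (\<Sum>k\<in>K. \<Sum>i'<s. (if i' = i then b i' k else 0) *\<^sub>C k)"
          unfolding v_def I_def sum.cartesian_product by (rule sum.cong) auto
        also have "\<dots> = (\<Sum>k\<in>K. \<Sum>i'<s. if i' = i then b i k *\<^sub>C k else 0)"
          by (intro sum.cong refl) auto
        also have "\<dots> = u i" using i by (simp add: b)
        finally show ?thesis by simp
      qed
      then show ?thesis by blast
    qed
    show ?thesis
    proof
      assume A': ?A
      show "psd_on (K \<times> {..<s}) (pick_matrix t c e)"
      proof (rule psd_onI)
        show "pick_matrix t c e l k = cnj (pick_matrix t c e k l)" for k l
          by (rule pick_matrix_commute)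
        show "0 \<le> Re (qform (K \<times> {..<s}) (pick_matrix t c e) a a)" for a
          using iff[of a] A' vV I_def by blast
      qed
    next
      assume psd: "psd_on (K \<times> {..<s}) (pick_matrix t c e)"
      show ?A
      proof (intro allI impI)
        fix u assume "\<forall>i<s. u i \<in> ?V"
        then obtain a where a: "\<forall>i<s. u i = v a i" using surj by blast
        have *: "L2_set (\<lambda>j. norm (\<Sum>i<s. A i j (v a i))) {..<t} \<le> c * L2_set (\<lambda>i. norm (v a i)) {..<s}"
          using iff psd_onD(2)[OF psd] I_def by blast
        show "L2_set (\<lambda>j. norm (\<Sum>i<s. A i j (u i))) {..<t} \<le> c * L2_set (\<lambda>i. norm (u i)) {..<s}"
        proof -
          have "L2_set (\<lambda>i. norm (u i)) {..<s} = L2_set (\<lambda>i. norm (v a i)) {..<s}"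
            by (rule L2_set_cong) (use a in auto)
          with * a show ?thesis by simp
        qed
      qed
    qed
  qed
  finally show ?thesis .
qed

section \<open>The McCullough-Quiggin kernel and the extension of multipliers\<close>

definition pick_kernel :: "'a::complex_inner \<Rightarrow> 'a \<Rightarrow> 'a \<Rightarrow> complex" where
  "pick_kernel n k l = 1 - cinner k n * cinner n l / (cinner k l * cinner n n)"

text \<open>
  In the proof, \<open>Q - \<Sum>j. a\<^sub>j a\<^sub>j\<^sup>*\<close> is the Pick matrix of \<open>e\<close>, and \<open>Q\<close> is the Schur product of this Pick
  matrix with \<open>pick_kernel n\<close> plus a Gram matrix. As \<open>pick_kernel n\<close> vanishes at \<open>n\<close>, \<open>Q\<close> is defined and
  positive on \<open>insert n S\<close> without knowing \<open>e\<close> at \<open>n\<close>, and extending the \<open>a\<^sub>j\<close> by Parrott's lemma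
  determines the missing eigenvalues.
\<close>

lemma pick_matrix_extension_insert:
  fixes S :: "'a::complex_inner set"
  assumes S: "finite S" "n \<notin> S" and nz: "\<And>k l. k \<in> insert n S \<Longrightarrow> l \<in> insert n S \<Longrightarrow> cinner k l \<noteq> 0"
    and m: "\<And>k l. k \<in> S \<Longrightarrow> l \<in> S \<Longrightarrow> pick_kernel n k l = (\<Sum>r<R::nat. m k r * cnj (m l r))"
    and psd: "psd_on (S \<times> {..<s}) (pick_matrix t c e)"
  shows "\<exists>e'. (\<forall>i j. \<forall>k\<in>S. e' i j k = e i j k) \<and> psd_on (insert n S \<times> {..<s}) (pick_matrix t c e')"
proof -
  define I where "I = S \<times> {..<s}"
  define J where "J = {n} \<times> {..<s}"
  have fin: "finite I" "finite J" and U: "I \<union> J = insert n S \<times> {..<s}"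
    using S by (auto simp: I_def J_def)
  define N where "N = complex_of_real (norm n)"
  have N0: "N \<noteq> 0" using nz[of n n] by (auto simp: N_def)
  have nn: "cinner n n = N * N" by (simp add: N_def cinner_self power2_eq_square)
  have N_cnj: "cnj N = N" by (simp add: N_def)
  have pk: "cinner k l * pick_kernel n k l = cinner k l - cinner k n * cinner n l / (N * N)"
    if "k \<in> insert n S" "l \<in> insert n S" for k l
    using nz[OF that] by (simp add: pick_kernel_def nn field_simps)
  have pk0: "pick_kernel n k l = 0" if "k \<in> insert n S" "l \<in> insert n S" "k = n \<or> l = n" for k l
    using nz[of n n] nz[OF that(1,2)] that(3) by (auto simp: pick_kernel_def)
  define E where "E p q = (\<Sum>j<t. e (snd p) j (fst p) * cnj (e (snd q) j (fst q)))" for p q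
  define D where "D p q = (if snd p = snd q then complex_of_real (c\<^sup>2) else 0)" for p q :: "'a \<times> nat"
  have PM: "pick_matrix t c e p q = cinner (fst p) (fst q) * (D p q - E p q)" for p q
    by (simp add: pick_matrix_def D_def E_def)
  define Q where "Q p q = D p q * cinner (fst p) (fst q) -
    cinner (fst p) (fst q) * pick_kernel n (fst p) (fst q) * E p q" for p q :: "'a \<times> nat"
  \<comment> \<open>With this normalization the sum of the \<open>a j p * cnj (a j q)\<close> is
    \<open>E p q\<close> times the product of the projections onto \<open>n\<close>, the part of
    \<open>cinner (fst p) (fst q) * E p q\<close> that the factor \<open>pick_kernel n\<close>
    leaves out of \<open>Q\<close>.\<close>
  define a where "a j p = e (snd p) j (fst p) * cinner (fst p) n / N" for j :: nat and p
  \<comment> \<open>The Schur product contains only a part of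
    \<open>D p q * cinner (fst p) (fst q)\<close>; the Gram matrix of \<open>b\<close> supplies the
    missing projection onto \<open>n\<close>.\<close>
  define b where "b p i = (if snd p = i then of_real c * cinner (fst p) n / N else 0)" for p :: "'a \<times> nat" and i
  have "psd_on I (\<lambda>p q. (\<Sum>r<R. m (fst p) r * cnj (m (fst q) r)) * pick_matrix t c e p q)"
    by (rule psd_on_gram_times) (use psd I_def in simp)
  then have "psd_on I (\<lambda>p q. pick_kernel n (fst p) (fst q) * pick_matrix t c e p q)"
    by (rule psd_on_cong) (auto simp: m I_def)
  then have "psd_on (I \<union> J) (\<lambda>p q. pick_kernel n (fst p) (fst q) * pick_matrix t c e p q)"
    by (rule psd_on_zero_extension) (use fin in \<open>auto simp: I_def J_def pk0\<close>)
  from psd_on_add[OF this psd_on_gram[where R = s and m = b]] have Q: "psd_on (I \<union> J) Q"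
  proof (rule psd_on_cong)
    fix p q assume p: "p \<in> I \<union> J" and q: "q \<in> I \<union> J"
    have "(\<Sum>i<s. b p i * cnj (b q i)) =
        (\<Sum>i<s. if i = snd p then b p (snd p) * cnj (b q (snd p)) else 0)"
      by (rule sum.cong) (auto simp: b_def)
    also have "\<dots> = D p q * (cinner (fst p) n * cinner n (fst q) / (N * N))"
      using p by (auto simp: U D_def b_def N_cnj cinner_commute[of n "fst q"] power2_eq_square)
    finally have b: "(\<Sum>i<s. b p i * cnj (b q i)) = \<dots>" .
    have "fst p \<in> insert n S" "fst q \<in> insert n S" using p q by (auto simp: I_def J_def)
    note pk = pk[OF this]
    have "pick_kernel n (fst p) (fst q) * pick_matrix t c e p q =
      cinner (fst p) (fst q) * pick_kernel n (fst p) (fst q) * D p q -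
      cinner (fst p) (fst q) * pick_kernel n (fst p) (fst q) * E p q"
      by (simp add: PM algebra_simps)
    then show "pick_kernel n (fst p) (fst q) * pick_matrix t c e p q + (\<Sum>i<s. b p i * cnj (b q i)) = Q p q"
      unfolding b Q_def by (simp add: pk) (simp add: algebra_simps)
  qed
  have aa: "(\<Sum>j<t. a j p * cnj (a j q)) = cinner (fst p) n * cinner n (fst q) / (N * N) * E p q" for p q
    unfolding a_def E_def sum_distrib_left
    by (rule sum.cong) (simp_all add: N_cnj cinner_commute[of n "fst q"])
  have "psd_on I (\<lambda>p q. Q p q - (\<Sum>j<t. a j p * cnj (a j q)))"
  proof (rule psd_on_cong)
    show "psd_on I (pick_matrix t c e)" using psd by (simp add: I_def)
    fix p q assume "p \<in> I" "q \<in> I"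
    then have "fst p \<in> insert n S" "fst q \<in> insert n S" by (auto simp: I_def)
    note pk = pk[OF this]
    show "pick_matrix t c e p q = Q p q - (\<Sum>j<t. a j p * cnj (a j q))"
      unfolding Q_def aa pk PM by (simp add: algebra_simps)
  qed
  from psd_on_extend[OF fin(2,1) Q this] obtain a' where a': "\<And>j p. p \<in> I \<Longrightarrow> a' j p = a j p"
    and psd': "psd_on (I \<union> J) (\<lambda>p q. Q p q - (\<Sum>j<t. a' j p * cnj (a' j q)))" by blast
  \<comment> \<open>At \<open>n\<close> the factor \<open>cinner n n / N\<close> equals
    \<open>N\<close>, so dividing by \<open>N\<close> turns the extended functional into an
    eigenvalue.\<close>
  define e' where "e' i j k = (if k = n then a' j (n, i) / N else e i j k)" for i j k
  have e'S: "e' i j k = e i j k" if "k \<in> S" for i j k using that S by (auto simp: e'_def)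
  have a'e': "a' j p = e' (snd p) j (fst p) * cinner (fst p) n / N" if "p \<in> I \<union> J" for j p
    using that
  proof
    assume "p \<in> I" then show ?thesis using a'[of p j] e'S by (auto simp: a_def I_def)
  next
    assume "p \<in> J" then show ?thesis using N0 by (auto simp: J_def e'_def nn)
  qed
  define E' where "E' p q = (\<Sum>j<t. e' (snd p) j (fst p) * cnj (e' (snd q) j (fst q)))" for p q
  have "psd_on (I \<union> J) (pick_matrix t c e')"
  proof (rule psd_on_cong[OF psd'])
    fix p q assume p: "p \<in> I \<union> J" and q: "q \<in> I \<union> J"
    have *: "(\<Sum>j<t. a' j p * cnj (a' j q)) = cinner (fst p) n * cinner n (fst q) / (N * N) * E' p q"
      unfolding E'_def sum_distrib_left a'e'[OF p] a'e'[OF q]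
      by (rule sum.cong) (simp_all add: N_cnj cinner_commute[of n "fst q"])
    have in': "fst p \<in> insert n S" "fst q \<in> insert n S" using p q by (auto simp: I_def J_def)
    \<comment> \<open>\<open>Q\<close> was formed with the arbitrary values of \<open>e\<close> at
      \<open>n\<close>; they meet a zero factor, so \<open>E\<close> may be exchanged for
      \<open>E'\<close>.\<close>
    have "pick_kernel n (fst p) (fst q) * E p q = pick_kernel n (fst p) (fst q) * E' p q"
    proof (cases "fst p = n \<or> fst q = n")
      case True
      then show ?thesis using pk0[OF in'] by simp
    next
      case False
      then have "E p q = E' p q" using in' e'S by (simp add: E_def E'_def)
      then show ?thesis by simp
    qed
    then have "Q p q = D p q * cinner (fst p) (fst q) -
      cinner (fst p) (fst q) * pick_kernel n (fst p) (fst q) * E' p q"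
      by (simp add: Q_def mult.assoc)
    then show "Q p q - (\<Sum>j<t. a' j p * cnj (a' j q)) = pick_matrix t c e' p q"
      unfolding * pk[OF in'] by (simp add: pick_matrix_def E'_def[symmetric] D_def[symmetric] algebra_simps)
  qed
  then show ?thesis using e'S unfolding U by blast
qed

lemma pick_matrix_extension:
  fixes K :: "'a::complex_inner set"
  assumes K: "finite K" "\<And>k l. k \<in> K \<Longrightarrow> l \<in> K \<Longrightarrow> cinner k l \<noteq> 0"
    and gram: "\<And>n. n \<in> K \<Longrightarrow> \<exists>(R::nat) m. \<forall>k\<in>K. \<forall>l\<in>K. pick_kernel n k l = (\<Sum>r<R. m k r * cnj (m l r))"
    and S: "S \<subseteq> K" and psd: "psd_on (S \<times> {..<s}) (pick_matrix t c e)"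
  shows "\<exists>e'. (\<forall>i j. \<forall>k\<in>S. e' i j k = e i j k) \<and> psd_on (K \<times> {..<s}) (pick_matrix t c e')"
proof -
  have "\<exists>e'. (\<forall>i j. \<forall>k\<in>S. e' i j k = e i j k) \<and> psd_on ((S \<union> T) \<times> {..<s}) (pick_matrix t c e')"
    if "finite T" "T \<subseteq> K" for T
    using that
  proof (induction T rule: finite_induct)
    case empty
    then show ?case using psd by auto
  next
    case (insert n T)
    then obtain e' where e': "\<forall>i j. \<forall>k\<in>S. e' i j k = e i j k"
      "psd_on ((S \<union> T) \<times> {..<s}) (pick_matrix t c e')" by blast
    show ?case
    proof (cases "n \<in> S")
      case True
      then have "S \<union> insert n T = S \<union> T" by auto
      then show ?thesis using e' by auto
    next
      case False
      obtain R m where m: "\<forall>k\<in>K. \<forall>l\<in>K. pick_kernel n k l = (\<Sum>r<R::nat. m k r * cnj (m l r))"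
        using gram insert.prems by blast
      have sub: "insert n (S \<union> T) \<subseteq> K" using insert.prems S by auto
      have finST: "finite (S \<union> T)" by (rule finite_subset[OF _ K(1)]) (use sub in auto)
      have "\<exists>e''. (\<forall>i j. \<forall>k\<in>S \<union> T. e'' i j k = e' i j k) \<and>
          psd_on (insert n (S \<union> T) \<times> {..<s}) (pick_matrix t c e'')"
      proof (rule pick_matrix_extension_insert[where m = m and R = R, OF finST _ _ _ e'(2)])
        show "n \<notin> S \<union> T" using False insert.hyps by simp
        show "cinner k l \<noteq> 0" if "k \<in> insert n (S \<union> T)" "l \<in> insert n (S \<union> T)" for k l
          using sub that by (intro K(2)) blast+
        show "pick_kernel n k l = (\<Sum>r<R. m k r * cnj (m l r))" if "k \<in> S \<union> T" "l \<in> S \<union> T" for k l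
          using sub that m by blast
      qed
      then show ?thesis using e'(1) by (metis Un_iff Un_insert_right)
    qed
  qed
  from this[of K] S show ?thesis using K(1) by (simp add: Un_absorb1)
qed

lemma multiplier_eigenvalues:
  assumes "\<forall>i<s. \<forall>j<t. multiplier K (F i j)"
  shows "\<exists>e. \<forall>i<s. \<forall>j<t. \<forall>k\<in>K. adjoint_on (cspan K) (F i j) k = e i j k *\<^sub>C k"
  using assms unfolding multiplier_def by metis

lemma rkhs_subset: "rkhs K \<Longrightarrow> S \<subseteq> K \<Longrightarrow> rkhs S"
  unfolding rkhs_def using complex_vector.independent_mono finite_subset by blast

text \<open>The sufficient half of the McCullough-Quiggin theorem in finite dimension. Extending
  with \<open>c\<close> the norm on \<open>S\<close> bounds the norm on \<open>K\<close> by
  \<open>c\<close>; the norm cannot drop, because the Pick matrix on \<open>S\<close> is a submatrix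
  of the one on \<open>K\<close>.\<close>

lemma complete_pick_if_gram:
  assumes K: "irreducible_rkhs K"
    and gram: "\<And>n. n \<in> K \<Longrightarrow> \<exists>(R::nat) m. \<forall>k\<in>K. \<forall>l\<in>K. pick_kernel n k l = (\<Sum>r<R. m k r * cnj (m l r))"
  shows "complete_pick K"
  unfolding complete_pick_def
proof (intro conjI allI impI)
  show "irreducible_rkhs K" by fact
  have rk: "rkhs K" and fin: "finite K" using K by (auto simp: irreducible_rkhs_def rkhs_def)
  have "0 \<notin> K"
    using K unfolding irreducible_rkhs_def rkhs_def by (metis complex_vector.dependent_zero)
  then have nz: "cinner k l \<noteq> 0" if "k \<in> K" "l \<in> K" for k l
    using K that by (cases "k = l") (auto simp: irreducible_rkhs_def)
  fix S s t and F :: "nat \<Rightarrow> nat \<Rightarrow> 'a \<Rightarrow> 'a"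
  assume S: "S \<subseteq> K" and F: "\<forall>i<s. \<forall>j<t. multiplier S (F i j)"
  have rkS: "rkhs S" by (rule rkhs_subset[OF rk S])
  obtain e where e: "\<And>i j k. i < s \<Longrightarrow> j < t \<Longrightarrow> k \<in> S \<Longrightarrow> adjoint_on (cspan S) (F i j) k = e i j k *\<^sub>C k"
    using multiplier_eigenvalues[OF F] by blast
  have Flin: "linear_operator_on (cspan S) (F i j)" if "i < s" "j < t" for i j
    using F that by (simp add: multiplier_def)
  define c where "c = matrix_opnorm s t (cspan S) F"
  have c0: "0 \<le> c" unfolding c_def by (rule matrix_opnorm_nonneg[OF rkS]) (rule Flin)
  have opS: "matrix_opnorm s t (cspan S) F \<le> d \<longleftrightarrow> psd_on (S \<times> {..<s}) (pick_matrix t d e)" if "0 \<le> d" for d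
    by (rule matrix_opnorm_le_iff_psd_on[OF rkS _ e that]) (use F in auto)
  have "psd_on (S \<times> {..<s}) (pick_matrix t c e)" using opS[OF c0] by (simp add: c_def)
  then obtain e' where e': "\<And>i j k. k \<in> S \<Longrightarrow> e' i j k = e i j k"
    and psd': "psd_on (K \<times> {..<s}) (pick_matrix t c e')"
    using pick_matrix_extension[OF fin nz gram S] by blast
  have "\<forall>i j. \<exists>M. multiplier K M \<and> (\<forall>k\<in>K. adjoint_on (cspan K) M k = e' i j k *\<^sub>C k)"
    by (intro allI multiplier_with_eigenvalues[OF rk])
  then obtain G where G: "\<And>i j. multiplier K (G i j)"
    and Ge: "\<And>i j k. k \<in> K \<Longrightarrow> adjoint_on (cspan K) (G i j) k = e' i j k *\<^sub>C k"
    by metis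
  have Glin: "linear_operator_on (cspan K) (G i j)" for i j using G by (simp add: multiplier_def)
  have ext: "extends_multiplier K S (G i j) (F i j)" if "i < s" "j < t" for i j
    unfolding extends_multiplier_def
  proof
    fix v assume "v \<in> cspan S"
    then obtain a where v: "v = (\<Sum>k\<in>S. a k *\<^sub>C k)"
      using cspan_finite_coords[of S v] rkS by (auto simp: rkhs_def)
    have "adjoint_on (cspan K) (G i j) v = (\<Sum>k\<in>S. a k *\<^sub>C adjoint_on (cspan K) (G i j) k)"
      unfolding v by (rule linear_operator_on_sum[OF linear_adjoint_on[OF fin Glin]])
        (use S in \<open>auto intro: complex_vector.span_base\<close>)
    also have "\<dots> = (\<Sum>k\<in>S. a k *\<^sub>C adjoint_on (cspan S) (F i j) k)"
      using S by (intro sum.cong refl) (auto simp: Ge e e' that)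
    also have "\<dots> = adjoint_on (cspan S) (F i j) v"
      unfolding v
      by (rule linear_operator_on_sum[OF linear_adjoint_on[OF _ Flin[OF that]], symmetric])
        (use rkS in \<open>auto simp: rkhs_def intro: complex_vector.span_base\<close>)
    finally show "adjoint_on (cspan K) (G i j) v = adjoint_on (cspan S) (F i j) v" .
  qed
  have opK: "matrix_opnorm s t (cspan K) G \<le> d \<longleftrightarrow> psd_on (K \<times> {..<s}) (pick_matrix t d e')" if "0 \<le> d" for d
    by (rule matrix_opnorm_le_iff_psd_on[OF rk G Ge that])
  have "matrix_opnorm s t (cspan K) G \<le> c" using opK[OF c0] psd' by simp
  moreover have "c \<le> matrix_opnorm s t (cspan K) G"
  proof -
    let ?d = "matrix_opnorm s t (cspan K) G"
    have d0: "0 \<le> ?d" by (rule matrix_opnorm_nonneg[OF rk Glin])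
    have "psd_on (K \<times> {..<s}) (pick_matrix t ?d e')" using opK[OF d0] by simp
    then have "psd_on (S \<times> {..<s}) (pick_matrix t ?d e')"
      by (rule psd_on_subset) (use fin S in auto)
    then have "psd_on (S \<times> {..<s}) (pick_matrix t ?d e)"
      by (rule psd_on_cong) (auto simp: pick_matrix_def e')
    then show ?thesis using opS[OF d0] by (simp add: c_def)
  qed
  ultimately show "\<exists>G. (\<forall>i<s. \<forall>j<t. multiplier K (G i j) \<and> extends_multiplier K S (G i j) (F i j)) \<and>
      matrix_opnorm s t (cspan K) G = matrix_opnorm s t (cspan S) F"
    using G ext by (intro exI[of _ G]) (auto simp: c_def)
qed

text \<open>
  The rows \<open>W k\<close> define a contractive \<open>1 \<times> t\<close> multiplier matrix vanishing at \<open>m\<close> whose Pick matrix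
  has rank one, so that its contractive extension is constrained by a zero Schur complement.
\<close>

lemma complete_pick_gram_extension:
  fixes t :: nat
  assumes cpp: "complete_pick K" and S: "S \<subseteq> K" "m \<in> S" and p: "p \<in> K" and t: "1 \<le> t"
    and W: "\<And>k l. k \<in> S \<Longrightarrow> l \<in> S \<Longrightarrow> pick_kernel m k l = (\<Sum>r<t. W k r * cnj (W l r))"
  shows "\<exists>V. (\<forall>l\<in>S. pick_kernel m p l = (\<Sum>r<t. V r * cnj (W l r))) \<and>
    (\<Sum>r<t. (cmod (V r))\<^sup>2) \<le> Re (pick_kernel m p p)"
proof -
  have K: "irreducible_rkhs K" using cpp by (simp add: complete_pick_def)
  have rk: "rkhs K" and fin: "finite K" using K by (auto simp: irreducible_rkhs_def rkhs_def)
  have "0 \<notin> K"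
    using K unfolding irreducible_rkhs_def rkhs_def by (metis complex_vector.dependent_zero)
  then have nz: "cinner k l \<noteq> 0" if "k \<in> K" "l \<in> K" for k l
    using K that by (cases "k = l") (auto simp: irreducible_rkhs_def)
  have mK: "m \<in> K" using S by auto
  have rkS: "rkhs S" by (rule rkhs_subset[OF rk S(1)])
  let ?e = "\<lambda>i j k. W k j"
  have "\<forall>j. \<exists>M. multiplier S M \<and> (\<forall>k\<in>S. adjoint_on (cspan S) M k = W k j *\<^sub>C k)"
    by (intro allI multiplier_with_eigenvalues[OF rkS])
  then obtain f where f: "\<And>j. multiplier S (f j)"
    "\<And>j k. k \<in> S \<Longrightarrow> adjoint_on (cspan S) (f j) k = W k j *\<^sub>C k" by metis
  define F where "F = (\<lambda>(i::nat) j. f j)"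
  have pk: "cinner k l * (1 - pick_kernel m k l) = cinner k m * cinner m l / cinner m m"
    if "k \<in> K" "l \<in> K" for k l
    using nz[OF that] by (simp add: pick_kernel_def)
  have opF: "matrix_opnorm 1 t (cspan S) F \<le> 1 \<longleftrightarrow> psd_on (S \<times> {..<1}) (pick_matrix t 1 ?e)"
    by (rule matrix_opnorm_le_iff_psd_on[OF rkS]) (use f in \<open>auto simp: F_def\<close>)
  have mm: "cinner m m = complex_of_real ((norm m)\<^sup>2)" by (rule cinner_self)
  \<comment> \<open>The vector behind the rank one Pick matrix: inner products with
    \<open>m\<close>, normalized. Positivity makes the rows \<open>W\<close> contractive.\<close>
  let ?b = "\<lambda>p (r::nat). cinner (fst p) m / of_real (norm m)"
  have "psd_on (S \<times> {..<1}) (\<lambda>p q. \<Sum>r<1. ?b p r * cnj (?b q r))" by (rule psd_on_gram)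
  then have "psd_on (S \<times> {..<1}) (pick_matrix t 1 ?e)"
  proof (rule psd_on_cong)
    fix p q assume p: "p \<in> S \<times> {..<1::nat}" and q: "q \<in> S \<times> {..<1::nat}"
    have "pick_matrix t 1 ?e p q = cinner (fst p) (fst q) * (1 - pick_kernel m (fst p) (fst q))"
      using p q W by (auto simp: pick_matrix_def)
    also have "\<dots> = cinner (fst p) m * cinner m (fst q) / cinner m m"
      by (rule pk) (use p q S in auto)
    finally show "(\<Sum>r<1. ?b p r * cnj (?b q r)) = pick_matrix t 1 ?e p q"
      by (simp add: mm cinner_commute[of m "fst q"] power2_eq_square)
  qed
  then have "matrix_opnorm 1 t (cspan S) F \<le> 1" using opF by blast
  moreover have "\<forall>i<1. \<forall>j<t. multiplier S (F i j)" using f by (simp add: F_def)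
  ultimately obtain G where G: "\<forall>i<1. \<forall>j<t. multiplier K (G i j)"
    and GF: "\<And>j. j < t \<Longrightarrow> extends_multiplier K S (G 0 j) (F 0 j)"
    and G1: "matrix_opnorm 1 t (cspan K) G \<le> 1"
    using cpp S t unfolding complete_pick_def
    by (metis le_refl less_one)
  obtain e where e: "\<And>i j k. i < 1 \<Longrightarrow> j < t \<Longrightarrow> k \<in> K \<Longrightarrow> adjoint_on (cspan K) (G i j) k = e i j k *\<^sub>C k"
    using multiplier_eigenvalues[OF G] by blast
  have eW: "e 0 j k = W k j" if "k \<in> S" "j < t" for k j
  proof -
    have "e 0 j k *\<^sub>C k = W k j *\<^sub>C k"
      using GF[OF that(2)] that S(1) e[of 0 j k] f(2)[of k j] complex_vector.span_base[OF that(1)]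
      by (auto simp: extends_multiplier_def F_def)
    moreover have "k \<noteq> 0" using that S(1) \<open>0 \<notin> K\<close> by auto
    ultimately show ?thesis by simp
  qed
  have "matrix_opnorm 1 t (cspan K) G \<le> 1 \<longleftrightarrow> psd_on (K \<times> {..<1}) (pick_matrix t 1 e)"
    by (rule matrix_opnorm_le_iff_psd_on[OF rk _ e]) (use G in auto)
  with G1 have psd: "psd_on (K \<times> {..<1}) (pick_matrix t 1 e)" (is "psd_on ?I ?B") by blast
  have finI: "finite ?I" using fin by simp
  define V where "V k r = e 0 r k" for k r
  define d where "d q = (\<lambda>k. if k = q then 1 else (0::complex))" for q :: "'a \<times> nat"
  \<comment> \<open>Coordinates of the component of \<open>q\<close> orthogonal to
    \<open>m\<close>.\<close>
  define u where "u q = (\<lambda>k. d (q, 0) k + (- (cinner q m / cinner m m)) * d (m, 0) k)" for q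
  have B: "?B (k, 0) (l, 0) = cinner k l * (1 - (\<Sum>r<t. V k r * cnj (V l r)))" for k l
    by (simp add: pick_matrix_def V_def)
  have VW: "V k r = W k r" if "k \<in> S" "r < t" for k r using eW that by (simp add: V_def)
  \<comment> \<open>The kernel \<open>pick_kernel m\<close> vanishes at \<open>m\<close>, hence so
    does the row \<open>W m\<close>, and the Pick matrix of the extension coincides with the Gram
    matrix in the row and column of \<open>m\<close>.\<close>
  have Wm: "W m r = 0" if "r < t" for r
  proof -
    have "complex_of_real (\<Sum>r<t. (cmod (W m r))\<^sup>2) = (\<Sum>r<t. W m r * cnj (W m r))"
      unfolding of_real_sum complex_norm_square ..
    also have "\<dots> = pick_kernel m m m" using W S by simp
    also have "\<dots> = 0" using nz[OF mK mK] by (simp add: pick_kernel_def)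
    finally have "(\<Sum>r<t. (cmod (W m r))\<^sup>2) = 0" by (simp only: of_real_eq_0_iff)
    then show ?thesis using that by (simp add: sum_nonneg_eq_0_iff)
  qed
  have Bm: "?B (k, 0) (m, 0) = cinner k m" "?B (m, 0) (k, 0) = cinner m k" for k
    using S by (simp_all add: B VW Wm)
  have d: "qform ?I ?B (d (k, 0)) (d (l, 0)) = ?B (k, 0) (l, 0)" if "k \<in> K" "l \<in> K" for k l
    unfolding d_def by (rule qform_delta) (use finI that in auto)
  have u: "qform ?I ?B (u k) (u l) = cinner k l * (pick_kernel m k l - (\<Sum>r<t. V k r * cnj (V l r)))"
    if kl: "k \<in> K" "l \<in> K" for k l
  proof -
    have "qform ?I ?B (u k) (u l) = ?B (k, 0) (l, 0) - cinner k m * cinner m l / cinner m m"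
      unfolding u_def
      by (simp only: qform_add qform_scale d kl mK Bm)
        (use nz[OF mK mK] in \<open>simp add: cinner_commute[of l m] mm field_simps\<close>)
    then show ?thesis unfolding B pk[OF kl, symmetric] by (simp add: algebra_simps)
  qed
  have "pick_kernel m p l = (\<Sum>r<t. V p r * cnj (W l r))" if l: "l \<in> S" for l
  proof -
    have lK: "l \<in> K" using l S by auto
    \<comment> \<open>On \<open>S\<close> the two terms of \<open>u\<close> cancel by the
      decomposition \<open>W\<close>, so \<open>u l\<close> is a null vector; its pairing with
      \<open>u p\<close> must vanish, which is the claimed identity.\<close>
    have "qform ?I ?B (u l) (u l) = 0" unfolding u[OF lK lK] by (simp add: W l VW)
    then have "qform ?I ?B (u l) (u p) = 0" by (intro psd_on_null[OF psd]) simp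
    then have 0: "qform ?I ?B (u p) (u l) = 0"
      using qform_commute[of ?I ?B, OF psd_onD(1)[OF psd]] by (metis complex_cnj_zero)
    show ?thesis using 0[unfolded u[OF p lK]] nz[OF p lK] l by (simp add: VW)
  qed
  moreover have "(\<Sum>r<t. (cmod (V p r))\<^sup>2) \<le> Re (pick_kernel m p p)"
  proof -
    have "0 \<le> Re (qform ?I ?B (u p) (u p))" by (rule psd_onD(2)[OF psd])
    also have "qform ?I ?B (u p) (u p) = of_real ((norm p)\<^sup>2) * (pick_kernel m p p - of_real (\<Sum>r<t. (cmod (V p r))\<^sup>2))"
      unfolding u[OF p p] cinner_self of_real_sum complex_norm_square ..
    finally have "0 \<le> (norm p)\<^sup>2 * (Re (pick_kernel m p p) - (\<Sum>r<t. (cmod (V p r))\<^sup>2))"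
      by (simp only: Re_complex_of_real Im_complex_of_real times_complex.sel minus_complex.sel)
    moreover have "p \<noteq> 0" using p \<open>0 \<notin> K\<close> by auto
    ultimately show ?thesis by (simp add: zero_le_mult_iff)
  qed
  ultimately show ?thesis by (intro exI[of _ "V p"]) auto
qed

section \<open>The four dimensional example\<close>

text \<open>The scalars cancel: numerator and denominator of the quotient acquire the same factor
  \<open>?c\<close>.\<close>

lemma labelled_rescaling_pick_kernel:
  assumes "labelled_rescaling I g h" "n \<in> I" "k \<in> I" "l \<in> I"
  shows "pick_kernel (h n) (h k) (h l) = pick_kernel (g n) (g k) (g l)"
proof -
  obtain c where c: "\<And>r. r \<in> I \<Longrightarrow> c r \<noteq> 0"
    "\<And>r q. r \<in> I \<Longrightarrow> q \<in> I \<Longrightarrow> cinner (h r) (h q) = c r * cnj (c q) * cinner (g r) (g q)"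
  proof -
    obtain \<theta> where \<theta>: "\<forall>r\<in>I. \<theta> (h r) = g r" and resc: "rescaling_via \<theta> (g ` I) (h ` I)"
      using assms(1) by (auto simp: labelled_rescaling_def)
    obtain \<gamma> where \<gamma>: "\<forall>v\<in>h ` I. \<gamma> v \<noteq> (0::complex)"
        "\<forall>u\<in>h ` I. \<forall>v\<in>h ` I. cinner u v = \<gamma> u * cnj (\<gamma> v) * cinner (\<theta> u) (\<theta> v)"
      using resc by (auto simp: rescaling_via_def)
    show thesis
      by (rule that[of "\<gamma> \<circ> h"]) (use \<theta> \<gamma> in auto)
  qed
  let ?c = "c k * cnj (c n) * (c n * cnj (c l))"
  have "?c \<noteq> 0" using c(1) assms by simp
  moreover have "cinner (h k) (h n) * cinner (h n) (h l) = ?c * (cinner (g k) (g n) * cinner (g n) (g l))"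
    "cinner (h k) (h l) * cinner (h n) (h n) = ?c * (cinner (g k) (g l) * cinner (g n) (g n))"
    using c(2) assms by simp_all
  ultimately show ?thesis by (simp add: pick_kernel_def)
qed

lemma labelled_rescaling_refl: "labelled_rescaling I h h"
  unfolding labelled_rescaling_def rescaling_via_def
  by (intro exI[of _ "\<lambda>v. v"] conjI exI[of _ "\<lambda>_. 1"]) (auto simp: bij_betw_def)

text \<open>Cholesky factorization of the block on \<open>{a, b}\<close>; the row \<open>W n\<close>
  is zero because \<open>f\<close> vanishes at \<open>n\<close>.\<close>

lemma gram_decomposition_two:
  fixes f :: "'i \<Rightarrow> 'i \<Rightarrow> complex"
  assumes ne: "a \<noteq> b" "a \<noteq> n" "b \<noteq> n" and zero: "\<And>k. k \<in> {a, b, n} \<Longrightarrow> f n k = 0 \<and> f k n = 0"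
    and AD: "f a a = of_real A" "f b b = of_real D" "0 \<le> A" "0 \<le> D"
    and ab: "f b a = cnj (f a b)" "(cmod (f a b))\<^sup>2 \<le> A * D"
  shows "\<exists>W. \<forall>k\<in>{a, b, n}. \<forall>l\<in>{a, b, n}. f k l = (\<Sum>r<2::nat. W k r * cnj (W l r))"
proof -
  define p where "p = complex_of_real (sqrt A)"
  \<comment> \<open>For \<open>A = 0\<close> the assumptions force \<open>f a b = 0\<close>, and
    division by zero gives \<open>q = 0\<close> and \<open>d = D\<close>, so the same formulas
    remain correct.\<close>
  define q where "q = cnj (f a b) / p"
  define d where "d = D - (cmod (f a b))\<^sup>2 / A"
  have pp: "p * cnj p = of_real A" using AD by (simp add: p_def flip: of_real_mult)
  have p0: "p = 0 \<longleftrightarrow> A = 0" by (simp add: p_def)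
  have f0: "f a b = 0" if "A = 0" using ab(2) that by simp
  have pq: "p * cnj q = f a b"
    using f0 p0 by (cases "A = 0") (auto simp: q_def p_def)
  have d0: "0 \<le> d"
    using ab AD f0 by (cases "A = 0") (auto simp: d_def field_simps)
  have "q * cnj q = of_real ((cmod (f a b))\<^sup>2 / A)"
    unfolding q_def of_real_divide complex_norm_square using pp by (simp add: mult.commute)
  moreover define r where "r = complex_of_real (sqrt d)"
  have "r * cnj r = of_real d" using d0 by (simp add: r_def flip: of_real_mult)
  ultimately have qr: "q * cnj q + r * cnj r = of_real D" by (simp add: d_def)
  define W where "W k i = (if k = a then (if i = 0 then p else 0) else
    if k = b then (if i = 0 then q else r) else 0)" for k and i :: nat
  have W: "(\<Sum>i<2. W k i * cnj (W l i)) = W k 0 * cnj (W l 0) + W k 1 * cnj (W l 1)" for k l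
    by (simp add: numeral_2_eq_2)
  have "q * cnj p = cnj (f a b)" unfolding pq[symmetric] by simp
  then have "\<forall>k\<in>{a, b, n}. \<forall>l\<in>{a, b, n}. f k l = (\<Sum>i<2. W k i * cnj (W l i))"
    using ne zero AD ab(1) unfolding W
    by (auto simp: W_def pp pq qr)
  then show ?thesis by blast
qed

text \<open>The right side minus the left side, multiplied by \<open>(cmod u)^2\<close>, is the
  expression in the hypothesis. Up to conjugations that expression treats \<open>u\<close>,
  \<open>v\<close>, \<open>w\<close> alike, so one computation serves every base point of a
  triple.\<close>

lemma cmod_pick_entry_le:
  fixes u v w :: complex
  assumes u: "u \<noteq> 0" and \<Delta>: "0 \<le> 2 * Re (u * cnj w * cnj v) + (cmod u)\<^sup>2 * (cmod v)\<^sup>2 * (cmod w)\<^sup>2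
    - (cmod u)\<^sup>2 * (cmod v)\<^sup>2 - (cmod v)\<^sup>2 * (cmod w)\<^sup>2 - (cmod w)\<^sup>2 * (cmod u)\<^sup>2"
  shows "(cmod (1 - v * w / u))\<^sup>2 \<le> (1 - (cmod v)\<^sup>2) * (1 - (cmod w)\<^sup>2)"
proof -
  have "1 - v * w / u = (u - v * w) / u" using u by (simp add: field_simps)
  then have "(cmod (1 - v * w / u))\<^sup>2 * (cmod u)\<^sup>2 = (cmod (u - v * w))\<^sup>2"
    using u by (simp add: norm_divide power_divide)
  also have "\<dots> = (cmod u)\<^sup>2 + (cmod v)\<^sup>2 * (cmod w)\<^sup>2 - 2 * Re (u * cnj w * cnj v)"
    unfolding cmod_power2 by (simp add: power2_eq_square algebra_simps)
  also have "\<dots> \<le> ((1 - (cmod v)\<^sup>2) * (1 - (cmod w)\<^sup>2)) * (cmod u)\<^sup>2"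
    using \<Delta> by (simp add: algebra_simps)
  finally show ?thesis using u by simp
qed

text \<open>Three vectors in a two dimensional space have a singular Gram matrix. Raising the last
  diagonal entry from \<open>C\<close> to \<open>E\<close> therefore leaves
  \<open>(E - C) * (A * B - (cmod p)^2)\<close>, whose second factor is a square by the Lagrange
  identity.\<close>

lemma gram_det_nonneg:
  fixes u v w :: "nat \<Rightarrow> complex"
  defines "p \<equiv> \<Sum>i<2. u i * cnj (v i)" and "q \<equiv> \<Sum>i<2. v i * cnj (w i)" and "r \<equiv> \<Sum>i<2. w i * cnj (u i)"
    and "A \<equiv> \<Sum>i<2. (cmod (u i))\<^sup>2" and "B \<equiv> \<Sum>i<2. (cmod (v i))\<^sup>2"
  assumes E: "(\<Sum>i<2. (cmod (w i))\<^sup>2) \<le> E"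
  shows "0 \<le> A * B * E + 2 * Re (p * q * r) - A * (cmod q)\<^sup>2 - B * (cmod r)\<^sup>2 - E * (cmod p)\<^sup>2"
proof -
  define C where "C = (\<Sum>i<2. (cmod (w i))\<^sup>2)"
  have s: "(\<Sum>i<2. f i) = f 0 + f 1" for f :: "nat \<Rightarrow> 'b::comm_monoid_add"
    by (simp add: numeral_2_eq_2)
  have "complex_of_real (A * B - (cmod p)\<^sup>2) = of_real ((cmod (u 0 * v 1 - u 1 * v 0))\<^sup>2)"
    unfolding of_real_diff of_real_mult A_def B_def p_def s of_real_add complex_norm_square
    by (simp add: algebra_simps)
  then have AB: "A * B - (cmod p)\<^sup>2 = (cmod (u 0 * v 1 - u 1 * v 0))\<^sup>2" by (simp only: of_real_eq_iff)
  define z where "z = 2 * Re (p * q * r)"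
  have z: "complex_of_real z = p * q * r + cnj (p * q * r)" unfolding z_def by (simp only: complex_add_cnj)
  have "complex_of_real (A * B * C + 2 * Re (p * q * r) - A * (cmod q)\<^sup>2 - B * (cmod r)\<^sup>2 - C * (cmod p)\<^sup>2) =
    of_real A * of_real B * of_real C + (p * q * r + cnj (p * q * r)) - of_real A * of_real ((cmod q)\<^sup>2)
    - of_real B * of_real ((cmod r)\<^sup>2) - of_real C * of_real ((cmod p)\<^sup>2)"
    unfolding z_def[symmetric] z[symmetric] by simp
  also have "\<dots> = 0"
    unfolding A_def B_def C_def p_def q_def r_def s of_real_add complex_norm_square
    by (simp add: algebra_simps)
  finally have "A * B * C + 2 * Re (p * q * r) - A * (cmod q)\<^sup>2 - B * (cmod r)\<^sup>2 - C * (cmod p)\<^sup>2 = 0"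
    by (simp only: of_real_eq_0_iff)
  then have "A * B * E + 2 * Re (p * q * r) - A * (cmod q)\<^sup>2 - B * (cmod r)\<^sup>2 - E * (cmod p)\<^sup>2 =
    (E - C) * (A * B - (cmod p)\<^sup>2)" by (simp add: algebra_simps)
  also have "\<dots> \<ge> 0" unfolding AB using E by (simp add: C_def)
  finally show ?thesis .
qed

text \<open>Every triple of labels contains exactly one of the pairs {1, 4} and {2, 3}, whose
  entries are not real. Hence the triple product has real part \<open>x^3\<close>, and the squared
  moduli are \<open>x^2\<close>, \<open>x^2\<close> and \<open>x^2 + s^2\<close> in some
  order.\<close>

lemma gram_matrix_triple:
  assumes "0 < x" "i \<noteq> j" "j \<noteq> k" "i \<noteq> k"
  defines "g \<equiv> \<lambda>i j. gram_matrix x $ i $ j"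
  shows "2 * Re (g i j * g j k * g k i) + (cmod (g i j))\<^sup>2 * (cmod (g j k))\<^sup>2 * (cmod (g k i))\<^sup>2
    - (cmod (g i j))\<^sup>2 * (cmod (g j k))\<^sup>2 - (cmod (g j k))\<^sup>2 * (cmod (g k i))\<^sup>2
    - (cmod (g k i))\<^sup>2 * (cmod (g i j))\<^sup>2 = x ^ 4 * (1 - x)\<^sup>2 * (1 + x)"
proof -
  define s where "s = (1 - x) * sqrt x"
  have s2: "s\<^sup>2 = (1 - x)\<^sup>2 * x" using assms(1) by (simp add: s_def power_mult_distrib)
  \<comment> \<open>\<open>G\<close> is meant to agree with \<open>g\<close> off the diagonal only,
    which is all that distinct labels need.\<close>
  define G where "G i j = (if (i, j) = (1, 4) \<or> (i, j) = (3, 2) then Complex x s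
    else if (i, j) = (4, 1) \<or> (i, j) = (2, 3) then Complex x (- s)
    else complex_of_real x)" for i j :: 4
  have gG: "\<forall>i j. i \<noteq> j \<longrightarrow> g i j = G i j"
    unfolding forall_4 g_def gram_matrix_def Let_def s_def[symmetric] G_def
    by (simp add: complex_eq_iff)
  have cz: "(cmod (Complex x s))\<^sup>2 = x\<^sup>2 + (1 - x)\<^sup>2 * x" "(cmod (Complex x (- s)))\<^sup>2 = x\<^sup>2 + (1 - x)\<^sup>2 * x"
     by (simp_all add: cmod_power2 s2)
  have "\<forall>i j k. i \<noteq> j \<and> j \<noteq> k \<and> i \<noteq> k \<longrightarrow>
    2 * Re (G i j * G j k * G k i) + (cmod (G i j))\<^sup>2 * (cmod (G j k))\<^sup>2 * (cmod (G k i))\<^sup>2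
    - (cmod (G i j))\<^sup>2 * (cmod (G j k))\<^sup>2 - (cmod (G j k))\<^sup>2 * (cmod (G k i))\<^sup>2
    - (cmod (G k i))\<^sup>2 * (cmod (G i j))\<^sup>2 = x ^ 4 * (1 - x)\<^sup>2 * (1 + x)"
    unfolding forall_4 G_def
    by (simp add: cz del: of_real_add of_real_mult) (simp add: algebra_simps eval_nat_numeral)
  then show ?thesis using gG assms(2-4) by (metis (no_types, lifting))
qed

lemma gram_matrix_diag: "gram_matrix x $ i $ i = 1"
proof -
  have "\<forall>i. gram_matrix x $ i $ i = 1"
    unfolding forall_4 gram_matrix_def Let_def by simp
  then show ?thesis by blast
qed

lemma pick_kernel_commute: "pick_kernel n l k = cnj (pick_kernel n k l)"
  using cinner_commute[of n k] cinner_commute[of l n] cinner_commute[of l k] cinner_commute[of n n]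
  by (simp add: pick_kernel_def mult.commute)

theorem proposition6p9:
  fixes x :: real
    and h :: "4 \<Rightarrow> 'a::complex_inner"
  assumes "0 < x" and "x < 1"
    and "inj h" and "irreducible_rkhs (range h)"
    and "\<forall>i j. cinner (h i) (h j) = gram_matrix x $ i $ j"
  shows "((\<forall>i. complete_pick (h ` (- {i}))) \<and> coherent (\<lambda>i. h)) \<and>
    (\<exists>h' :: 4 \<Rightarrow> 'a. inj h' \<and> irreducible_rkhs (range h') \<and> (\<lambda>i. h) \<rightrightarrows> h') \<and>
    \<not> (\<exists>h' :: 4 \<Rightarrow> 'b::complex_inner.
         inj h' \<and> complete_pick (range h') \<and> (\<lambda>i. h) \<rightrightarrows> h')"
proof -
  note x = assms(1,2) and inj = assms(3) and K = assms(4) and g = assms(5)[rule_format]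
  have unit: "cinner (h i) (h i) = 1" for i by (simp add: g gram_matrix_diag)
  then have norm1: "norm (h i) = 1" for i
  proof -
    have "complex_of_real ((norm (h i))\<^sup>2) = of_real 1" by (simp add: cinner_self[symmetric] unit del: of_real_power)
    then have "(norm (h i))\<^sup>2 = 1" by (simp only: of_real_eq_iff)
    then show ?thesis by (simp add: power2_eq_1_iff) (use norm_ge_zero[of "h i"] in linarith)
  qed
  have nz: "cinner (h i) (h j) \<noteq> 0" for i j
  proof (cases "i = j")
    case False
    then have "h i \<noteq> h j" using inj by (simp add: inj_eq)
    then show ?thesis using K by (auto simp: irreducible_rkhs_def)
  qed (simp add: unit)
  define M where "M n k l = pick_kernel (h n) (h k) (h l)" for n k l
  have M: "M n k l = 1 - cinner (h k) (h n) * cinner (h n) (h l) / cinner (h k) (h l)" for n k l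
    by (simp add: M_def pick_kernel_def unit)
  have Mn: "M n n k = 0" "M n k n = 0" for n k using nz by (simp_all add: M unit)
  have Mdiag: "M n k k = of_real (1 - (cmod (cinner (h k) (h n)))\<^sup>2)" for n k
    using cinner_commute[of "h n" "h k"] by (simp add: M unit complex_norm_square[symmetric])
  have le1: "0 \<le> 1 - (cmod (cinner (h k) (h n)))\<^sup>2" for n k
    using cinner_le_norm[of "h k" "h n"] by (simp add: norm1 abs_square_le_1)
  have Mcnj: "M n l k = cnj (M n k l)" for n k l unfolding M_def by (rule pick_kernel_commute)
  have dec: "\<exists>W. \<forall>k\<in>{a, b, n}. \<forall>l\<in>{a, b, n}. M n k l = (\<Sum>r<2::nat. W k r * cnj (W l r))"
    if ne: "a \<noteq> b" "a \<noteq> n" "b \<noteq> n" for a b n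
  proof (rule gram_decomposition_two[OF ne _ Mdiag Mdiag le1 le1 Mcnj])
    show "M n n k = 0 \<and> M n k n = 0" for k by (simp add: Mn)
    \<comment> \<open>These conjugations turn the triple product of
      \<open>cmod_pick_entry_le\<close> into the cyclic one of
      \<open>gram_matrix_triple\<close>.\<close>
    have c: "cnj (cinner (h a) (h n)) = cinner (h n) (h a)" "cnj (cinner (h n) (h b)) = cinner (h b) (h n)"
      by (metis cinner_commute)+
    have c': "cmod (cinner (h a) (h n)) = cmod (cinner (h n) (h a))" "cmod (cinner (h n) (h b)) = cmod (cinner (h b) (h n))"
      unfolding c[symmetric] by simp_all
    have "(cmod (M n a b))\<^sup>2 \<le> (1 - (cmod (cinner (h a) (h n)))\<^sup>2) * (1 - (cmod (cinner (h n) (h b)))\<^sup>2)"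
      unfolding M
    proof (rule cmod_pick_entry_le[OF nz])
      have "0 \<le> x ^ 4 * (1 - x)\<^sup>2 * (1 + x)" using x by simp
      also note gram_matrix_triple[OF x(1) ne(1,3,2), symmetric]
      finally show "0 \<le> 2 * Re (cinner (h a) (h b) * cnj (cinner (h n) (h b)) * cnj (cinner (h a) (h n))) +
        (cmod (cinner (h a) (h b)))\<^sup>2 * (cmod (cinner (h a) (h n)))\<^sup>2 * (cmod (cinner (h n) (h b)))\<^sup>2 -
        (cmod (cinner (h a) (h b)))\<^sup>2 * (cmod (cinner (h a) (h n)))\<^sup>2 -
        (cmod (cinner (h a) (h n)))\<^sup>2 * (cmod (cinner (h n) (h b)))\<^sup>2 -
        (cmod (cinner (h n) (h b)))\<^sup>2 * (cmod (cinner (h a) (h b)))\<^sup>2"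
        unfolding c c' g[symmetric] by (simp only: mult.commute mult.left_commute diff_diff_add add_ac)
    qed
    then show "(cmod (M n a b))\<^sup>2 \<le> (1 - (cmod (cinner (h a) (h n)))\<^sup>2) * (1 - (cmod (cinner (h b) (h n)))\<^sup>2)"
      using arg_cong[OF c(2), of cmod] by simp
  qed
  have pick: "complete_pick (h ` (- {i}))" for i
  proof (rule complete_pick_if_gram)
    show "irreducible_rkhs (h ` (- {i}))"
      using K rkhs_subset[of "range h" "h ` (- {i})"] by (auto simp: irreducible_rkhs_def)
    fix v assume "v \<in> h ` (- {i})"
    then obtain n where n: "v = h n" "n \<noteq> i" by auto
    have "\<exists>a b. a \<noteq> b \<and> a \<noteq> n \<and> b \<noteq> n \<and> - {i} = {a, b, n}"
    proof -
      have "card (UNIV - {i, n}) = 2" using n(2) by (subst card_Diff_subset) auto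
      moreover have "- {i} - {n} = UNIV - {i, n}" by auto
      ultimately have "card (- {i} - {n}) = 2" by simp
      then obtain a b where ab: "- {i} - {n} = {a, b}" "a \<noteq> b" unfolding card_2_iff by blast
      have "a \<noteq> n" "b \<noteq> n" using ab(1) by blast+
      moreover have "- {i} = insert n (- {i} - {n})" using n(2) by blast
      then have "- {i} = {a, b, n}" unfolding ab(1) by (simp add: insert_commute)
      ultimately show ?thesis using ab(2) by blast
    qed
    then obtain a b where ab: "a \<noteq> b" "a \<noteq> n" "b \<noteq> n" "- {i} = {a, b, n}" by blast
    obtain W where W: "\<forall>k\<in>- {i}. \<forall>l\<in>- {i}. M n k l = (\<Sum>r<2::nat. W k r * cnj (W l r))"
      using dec[OF ab(1-3)] unfolding ab(4) by blast
    show "\<exists>(R::nat) m. \<forall>k\<in>h ` (- {i}). \<forall>l\<in>h ` (- {i}). pick_kernel v k l = (\<Sum>r<R. m k r * cnj (m l r))"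
      by (rule exI[of _ 2], rule exI[of _ "\<lambda>v. W (inv h v)"]) (use W inj in \<open>auto simp: n M_def\<close>)
  qed
  have "\<not> (inj h' \<and> complete_pick (range h') \<and> (\<lambda>i. h) \<rightrightarrows> h')" for h' :: "4 \<Rightarrow> 'b"
  proof
    assume A: "inj h' \<and> complete_pick (range h') \<and> (\<lambda>i. h) \<rightrightarrows> h'"
    have M': "pick_kernel (h' n) (h' k) (h' l) = M n k l" for n k l
    proof -
      \<comment> \<open>Three of the four labels lie in a common \<open>- {i}\<close>, so each
        single value of the kernel is already determined by one \<open>J_i\<close>.\<close>
      have "card {n, k, l} < card (UNIV :: 4 set)"
        using card_insert_le_m1[of 3 "{k, l}" n] card_insert_le_m1[of 2 "{l}" k] by simp
      then have "\<exists>i. i \<notin> {n, k, l}" by (metis UNIV_eq_I less_irrefl)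
      then obtain i where "i \<notin> {n, k, l}" by blast
      then have "n \<in> - {i}" "k \<in> - {i}" "l \<in> - {i}" by auto
      moreover have "labelled_rescaling (- {i}) h h'" using A by (simp add: assembles_to_def)
      ultimately show ?thesis unfolding M_def by (intro labelled_rescaling_pick_kernel)
    qed
    \<comment> \<open>The rows belong to labels; \<open>inv h'\<close> below transports them to the
      kernels of the supposed space.\<close>
    obtain W where W: "\<forall>k\<in>{2, 3, 1}. \<forall>l\<in>{2, 3, 1}. M 1 k l = (\<Sum>r<2::nat. W k r * cnj (W l r))"
      using dec[of 2 3 1] by auto
    have inj': "inj h'" and cpp: "complete_pick (range h')" using A by auto
    have "\<exists>V. (\<forall>l\<in>h' ` {2, 3, 1}. pick_kernel (h' 1) (h' 4) l = (\<Sum>r<2::nat. V r * cnj (W (inv h' l) r))) \<and>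
      (\<Sum>r<2. (cmod (V r))\<^sup>2) \<le> Re (pick_kernel (h' 1) (h' 4) (h' 4))"
      by (rule complete_pick_gram_extension[OF cpp])
        (use W inj' in \<open>auto simp: M'\<close>)
    \<comment> \<open>On the labels 2, 3, 4 the matrix \<open>M 1\<close> is now the Gram matrix of
      \<open>W 2\<close>, \<open>W 3\<close>, \<open>V\<close>, except for a possibly larger last
      diagonal entry: the situation of \<open>gram_det_nonneg\<close>.\<close>
    then obtain V where V: "\<And>l. l \<in> {2, 3} \<Longrightarrow> M 1 4 l = (\<Sum>r<2::nat. V r * cnj (W l r))"
      "(\<Sum>r<2. (cmod (V r))\<^sup>2) \<le> Re (M 1 4 4)"
      using inj' by (auto simp: M')
    define s where "s = (1 - x) * sqrt x"
    have s2: "s\<^sup>2 = (1 - x)\<^sup>2 * x" using x by (simp add: s_def power_mult_distrib)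
    define P where "P = x\<^sup>2 + s\<^sup>2"
    have P: "P > 0" using x by (simp add: P_def add_pos_nonneg)
    have entries: "cinner (h 1) (h 2) = x" "cinner (h 2) (h 1) = x" "cinner (h 1) (h 3) = x" "cinner (h 3) (h 1) = x"
      "cinner (h 4) (h 1) = Complex x (- s)" "cinner (h 2) (h 3) = Complex x (- s)"
      "cinner (h 4) (h 2) = x" "cinner (h 4) (h 3) = x"
      by (simp_all add: g gram_matrix_def Let_def s_def complex_eq_iff)
    have cP: "(cmod (Complex x (- s)))\<^sup>2 = P" by (simp add: cmod_power2 P_def)
    have sq: "(\<Sum>r<2. (cmod (W k r))\<^sup>2) = 1 - (cmod (cinner (h k) (h 1)))\<^sup>2" if "k \<in> {2, 3}" for k
    proof -
      have "complex_of_real (\<Sum>r<2. (cmod (W k r))\<^sup>2) = (\<Sum>r<2. W k r * cnj (W k r))"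
        unfolding of_real_sum complex_norm_square ..
      also have "\<dots> = of_real (1 - (cmod (cinner (h k) (h 1)))\<^sup>2)"
        unfolding Mdiag[symmetric] using W that by auto
      finally show ?thesis by (simp only: of_real_eq_iff)
    qed
    have sq2: "(\<Sum>r<2. (cmod (W 2 r))\<^sup>2) = 1 - x\<^sup>2" "(\<Sum>r<2. (cmod (W 3 r))\<^sup>2) = 1 - x\<^sup>2"
      using sq[of 2] sq[of 3] x by (simp_all add: entries)
    let ?p = "M 1 2 3" and ?r = "M 1 4 2"
    have p: "(\<Sum>i<2. W 2 i * cnj (W 3 i)) = ?p" using W by auto
    have r: "(\<Sum>i<2. V i * cnj (W 2 i)) = ?r" using V by simp
    have q: "(\<Sum>i<2. W 3 i * cnj (V i)) = cnj ?r"
    proof -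
      \<comment> \<open>The kernels 2 and 3 have the same inner products with 1 and with 4.\<close>
      have "M 1 4 3 = ?r" using x by (simp add: M entries)
      then have "cnj ?r = cnj (\<Sum>r<2. V r * cnj (W 3 r))" using V by simp
      then show ?thesis by (simp add: mult.commute)
    qed
    have E: "Re (M 1 4 4) = 1 - P" unfolding Mdiag by (simp add: entries cP)
    have r1: "?r = Complex (1 - x) s" using x by (simp add: M entries complex_eq_iff)
    have cr: "(cmod ?r)\<^sup>2 = (1 - x)\<^sup>2 * (1 + x)"
      unfolding r1 cmod_power2 by (simp add: s2 algebra_simps)
    \<comment> \<open>The denominator of \<open>?p\<close> is the inner product of
      \<open>h 2\<close> and \<open>h 3\<close>, whose squared modulus is \<open>P\<close>;
      multiplying by \<open>P\<close> clears it.\<close>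
    have p1: "?p * P = P - x\<^sup>2 * Complex x s"
    proof -
      have "Complex x (- s) * Complex x s = of_real P"
        by (simp add: complex_eq_iff P_def power2_eq_square)
      moreover have "(1 - of_real x * of_real x / w) * w = w - complex_of_real x ^ 2" if "w \<noteq> 0" for w
        using that by (simp add: field_simps power2_eq_square)
      then have "?p * Complex x (- s) = Complex x (- s) - x\<^sup>2"
        using nz[of 2 3] unfolding M entries by simp
      ultimately show ?thesis by (metis mult.assoc left_diff_distrib)
    qed
    have Rep: "Re ?p * P = P - x ^ 3"
      using arg_cong[OF p1, of Re] by (simp add: power2_eq_square power3_eq_cube)
    have Imp: "Im ?p * P = - (x\<^sup>2 * s)"
      using arg_cong[OF p1, of Im] by simp
    have "(cmod ?p)\<^sup>2 * P\<^sup>2 = (P - x ^ 3)\<^sup>2 + (x\<^sup>2 * s)\<^sup>2"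
      unfolding cmod_power2 distrib_right power_mult_distrib[symmetric] Rep Imp by simp
    also have "\<dots> = (x * ((1 - x)\<^sup>2 * (1 + x))) * P"
      unfolding P_def using s2 by algebra
    finally have cp: "(cmod ?p)\<^sup>2 * P = x * ((1 - x)\<^sup>2 * (1 + x))"
      using P by (simp add: power2_eq_square)
    have "0 \<le> (1 - x\<^sup>2) * (1 - x\<^sup>2) * (1 - P) + 2 * Re (?p * cnj ?r * ?r) - (1 - x\<^sup>2) * (cmod (cnj ?r))\<^sup>2
      - (1 - x\<^sup>2) * (cmod ?r)\<^sup>2 - (1 - P) * (cmod ?p)\<^sup>2"
      using gram_det_nonneg[OF V(2), of "W 2" "W 3"] unfolding p q r sq2 E .
    also have "?p * cnj ?r * ?r = ?p * of_real ((cmod ?r)\<^sup>2)"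
      unfolding complex_norm_square by (simp add: mult_ac)
    finally have "0 \<le> (1 - x\<^sup>2) * (1 - x\<^sup>2) * (1 - P) + 2 * (Re ?p * (cmod ?r)\<^sup>2) - (1 - x\<^sup>2) * (cmod ?r)\<^sup>2
      - (1 - x\<^sup>2) * (cmod ?r)\<^sup>2 - (1 - P) * (cmod ?p)\<^sup>2"
      by simp
    \<comment> \<open>Scaling by \<open>P > 0\<close> lets \<open>Rep\<close> and \<open>cp\<close>
      remove \<open>?p\<close>, so that only a polynomial in \<open>x\<close> remains.\<close>
    then have "0 \<le> P * ((1 - x\<^sup>2) * (1 - x\<^sup>2) * (1 - P) + 2 * (Re ?p * (cmod ?r)\<^sup>2) - (1 - x\<^sup>2) * (cmod ?r)\<^sup>2
      - (1 - x\<^sup>2) * (cmod ?r)\<^sup>2 - (1 - P) * (cmod ?p)\<^sup>2)" using P by (intro mult_nonneg_nonneg) auto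
    also have "\<dots> = P * ((1 - x\<^sup>2) * (1 - x\<^sup>2)) * (1 - P) + 2 * (Re ?p * P * (cmod ?r)\<^sup>2)
      - 2 * P * (1 - x\<^sup>2) * (cmod ?r)\<^sup>2 - (1 - P) * ((cmod ?p)\<^sup>2 * P)"
      by (simp add: algebra_simps)
    also have "\<dots> = - (x ^ 4 * (1 - x) ^ 3 * (1 - x\<^sup>2) * (1 + x))"
      unfolding Rep cp cr unfolding P_def s2 by algebra
    also have "\<dots> < 0"
      using x power_strict_mono[of x 1 2] by simp
    finally show False by simp
  qed
  \<comment> \<open>All \<open>J_i\<close> are regular subspaces of the one space with kernels
    \<open>h\<close>, so the identity rescaling gives coherence, and \<open>h\<close> itself is the
    witness for (2).\<close>
  moreover have "coherent (\<lambda>i. h)" "(\<lambda>i. h) \<rightrightarrows> h"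
    by (auto simp: coherent_def assembles_to_def labelled_rescaling_refl)
  ultimately show ?thesis using pick inj K by blast
qed

end
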